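(* The morphism of operads $\psi:\mathrm{Dend}\to\mathrm{Mould}$ determined by $\psi(L)=\dfrac{1}{u_1(u_1+u_2)}$ and $\psi(R)=\dfrac{1}{(u_1+u_2)u_2}$ is injective (that is, $\psi:\mathrm{Dend}(n)\to\mathrm{Mould}(n)$ is injective for every $n\ge1$).
   Context: Notation: $u_{i\dots j}=\sum_{i\le k\le j}u_k$. The non-symmetric operad $\mathrm{Mould}$: $\mathrm{Mould}(n)$ ($n\ge1$) is the $\mathbb{Q}$-vector space of rational functions with rational coefficients in $u_1,\dots,u_n$; the unit is $1/u_1$; for $f\in\mathrm{Mould}(m)$, $g\in\mathrm{Mould}(n)$, $1\le i\le m$, $f\circ_i g=u_{i\dots i+n-1}f(u_1,\dots,u_{i-1},u_{i\dots i+n-1},u_{i+n},\dots,u_{m+n-1})g(u_i,\dots,u_{i+n-1})$. $\mathrm{Dend}$ (the Dendriform operad) is the non-symmetric operad in $\mathbb{Q}$-vector spaces generated by $L,R$ of arity $2$ with relations $L\circ_1(L+R)=L\circ_2L$, $R\circ_1L=L\circ_2R$, $R\circ_1R=R\circ_2(L+R)$. It is a known fact that $\mathrm{Dend}(n)$ has a basis indexed by the rooted planar binary trees with $n+1$ leaves, as follows. For $x\in\mathrm{Dend}(m)$, $y\in\mathrm{Dend}(n)$ put $x\succ y=(L\circ_2y)\circ_1x$ and $x\prec y=(R\circ_2y)\circ_1x$; the tree $Y$ with one inner vertex is the unit of the operad, and the tree with left subtree $A$ and right subtree $B$ is $(A\succ Y)\prec B$ (with the factor $A\succ$, resp. $\prec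 B$, omitted when $A$, resp. $B$, is a single leaf). *)

theory Defs
  imports Complex_Main "HOL-Library.Poly_Mapping" "HOL-Library.Tree" "HOL-Computational_Algebra.Fraction_Field"
begin

section \<open>Data of a non-symmetric operad over the rationals\<close>

text \<open>
  All components \<open>P(n)\<close> of an operad live in one type; the vector space operations carry the
  arity as an argument.  Only the arities \<open>n \<ge> 1\<close> are meaningful.
  \<open>op_comp P m n i f g\<close> is \<open>f \<circ>\<^sub>i g\<close> for \<open>f \<in> P(m)\<close>, \<open>g \<in> P(n)\<close>, \<open>1 \<le> i \<le> m\<close>.
\<close>

record 'a ns_operad =
  op_space :: "nat \<Rightarrow> 'a set"
  op_add :: "nat \<Rightarrow> 'a \<Rightarrow> 'a \<Rightarrow> 'a"
  op_scale :: "nat \<Rightarrow> rat \<Rightarrow> 'a \<Rightarrow> 'a"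
  op_unit :: 'a
  op_comp :: "nat \<Rightarrow> nat \<Rightarrow> nat \<Rightarrow> 'a \<Rightarrow> 'a \<Rightarrow> 'a"

definition operad_hom :: "'a ns_operad \<Rightarrow> 'b ns_operad \<Rightarrow> (nat \<Rightarrow> 'a \<Rightarrow> 'b) \<Rightarrow> bool" where
  "operad_hom P Q \<psi> \<longleftrightarrow>
     (\<forall>n\<ge>1. \<forall>x\<in>op_space P n. \<psi> n x \<in> op_space Q n) \<and>
     (\<forall>n\<ge>1. \<forall>x\<in>op_space P n. \<forall>y\<in>op_space P n.
        \<psi> n (op_add P n x y) = op_add Q n (\<psi> n x) (\<psi> n y)) \<and>
     (\<forall>n\<ge>1. \<forall>c. \<forall>x\<in>op_space P n. \<psi> n (op_scale P n c x) = op_scale Q n c (\<psi> n x)) \<and>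
     \<psi> 1 (op_unit P) = op_unit Q \<and>
     (\<forall>m\<ge>1. \<forall>n\<ge>1. \<forall>i\<in>{1..m}. \<forall>x\<in>op_space P m. \<forall>y\<in>op_space P n.
        \<psi> (m + n - 1) (op_comp P m n i x y) = op_comp Q m n i (\<psi> m x) (\<psi> n y))"

text \<open>
  The operad presented by relations \<open>f = g\<close> (for \<open>E n f g\<close>, with \<open>f, g \<in> P(n)\<close>): the quotient
  of \<open>P\<close> by the least congruence containing \<open>E\<close>; the class of \<open>0\<close> is the operadic ideal
  generated by the differences \<open>f - g\<close>.
\<close>

inductive operad_cong :: "'a ns_operad \<Rightarrow> (nat \<Rightarrow> 'a \<Rightarrow> 'a \<Rightarrow> bool) \<Rightarrow> nat \<Rightarrow> 'a \<Rightarrow> 'a \<Rightarrow> bool"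
  for P E where
  rel: "E n f g \<Longrightarrow> operad_cong P E n f g"
| refl: "f \<in> op_space P n \<Longrightarrow> operad_cong P E n f f"
| sym: "operad_cong P E n f g \<Longrightarrow> operad_cong P E n g f"
| trans: "operad_cong P E n f g \<Longrightarrow> operad_cong P E n g h \<Longrightarrow> operad_cong P E n f h"
| add: "operad_cong P E n f f' \<Longrightarrow> operad_cong P E n g g' \<Longrightarrow>
    operad_cong P E n (op_add P n f g) (op_add P n f' g')"
| scale: "operad_cong P E n f f' \<Longrightarrow> operad_cong P E n (op_scale P n c f) (op_scale P n c f')"
| comp: "operad_cong P E m f f' \<Longrightarrow> operad_cong P E n g g' \<Longrightarrow> 1 \<le> n \<Longrightarrow> 1 \<le> i \<Longrightarrow> i \<le> m \<Longrightarrow>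
    operad_cong P E (m + n - 1) (op_comp P m n i f g) (op_comp P m n i f' g')"

definition operad_cong_set :: "'a ns_operad \<Rightarrow> (nat \<Rightarrow> 'a \<Rightarrow> 'a \<Rightarrow> bool) \<Rightarrow> nat \<Rightarrow> ('a \<times> 'a) set" where
  "operad_cong_set P E n = {(f, g). operad_cong P E n f g}"

definition quotient_operad :: "'a ns_operad \<Rightarrow> (nat \<Rightarrow> 'a \<Rightarrow> 'a \<Rightarrow> bool) \<Rightarrow> 'a set ns_operad" where
  "quotient_operad P E =
     \<lparr> op_space = (\<lambda>n. op_space P n // operad_cong_set P E n),
       op_add = (\<lambda>n X Y. \<Union>x\<in>X. \<Union>y\<in>Y. operad_cong_set P E n `` {op_add P n x y}),
       op_scale = (\<lambda>n c X. \<Union>x\<in>X. operad_cong_set P E n `` {op_scale P n c x}),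
       op_unit = operad_cong_set P E 1 `` {op_unit P},
       op_comp = (\<lambda>m n i X Y.
         \<Union>x\<in>X. \<Union>y\<in>Y. operad_cong_set P E (m + n - 1) `` {op_comp P m n i x y}) \<rparr>"


section \<open>The free operad on binary generators\<close>

text \<open>
  A composite of binary generators of arity \<open>n\<close> is a planar binary tree with \<open>n\<close> leaves
  (counted by \<^const>\<open>size1\<close>, leaves numbered from \<open>1\<close>, left to right) whose inner vertices are
  labelled by generators.  \<open>graft i s t\<close> glues the root of \<open>t\<close> to the \<open>i\<close>-th leaf of \<open>s\<close>.
\<close>

fun graft :: "nat \<Rightarrow> 'g tree \<Rightarrow> 'g tree \<Rightarrow> 'g tree" where
  "graft i \<langle>\<rangle> t = t"
| "graft i \<langle>l, x, r\<rangle> t =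
     (if i \<le> size1 l then \<langle>graft i l t, x, r\<rangle> else \<langle>l, x, graft (i - size1 l) r t\<rangle>)"

definition free_operad :: "('g tree \<Rightarrow>\<^sub>0 rat) ns_operad" where
  "free_operad =
     \<lparr> op_space = (\<lambda>n. {f. \<forall>t\<in>Poly_Mapping.keys f. size1 t = n}),
       op_add = (\<lambda>n f g. f + g),
       op_scale = (\<lambda>n c f. Poly_Mapping.map ((*) c) f),
       op_unit = Poly_Mapping.single \<langle>\<rangle> 1,
       op_comp = (\<lambda>m n i f g.
         \<Sum>s\<in>Poly_Mapping.keys f. \<Sum>t\<in>Poly_Mapping.keys g.
           Poly_Mapping.single (graft i s t) (Poly_Mapping.lookup f s * Poly_Mapping.lookup g t)) \<rparr>"

definition free_gen :: "'g \<Rightarrow> 'g tree \<Rightarrow>\<^sub>0 rat" where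
  "free_gen x = Poly_Mapping.single \<langle>\<langle>\<rangle>, x, \<langle>\<rangle>\<rangle> 1"


section \<open>The Dendriform operad\<close>

datatype dend_gen = L | R

definition dend_rel :: "nat \<Rightarrow> (dend_gen tree \<Rightarrow>\<^sub>0 rat) \<Rightarrow> (dend_gen tree \<Rightarrow>\<^sub>0 rat) \<Rightarrow> bool" where
  "dend_rel n f g \<longleftrightarrow>
     (let l = free_gen L; r = free_gen R; c = op_comp free_operad 2 2
      in n = 3 \<and> (f, g) \<in>
           {(c 1 l (l + r), c 2 l l),
            (c 1 r l, c 2 l r),
            (c 1 r r, c 2 r (l + r))})"

definition Dend :: "(dend_gen tree \<Rightarrow>\<^sub>0 rat) set ns_operad" where
  "Dend = quotient_operad free_operad dend_rel"

definition dend_class :: "dend_gen \<Rightarrow> (dend_gen tree \<Rightarrow>\<^sub>0 rat) set" where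
  "dend_class x = operad_cong_set free_operad dend_rel 2 `` {free_gen x}"


section \<open>Rational functions\<close>

text \<open>Polynomials and rational functions over the rationals in the variables \<open>u\<^sub>k\<close>, \<open>k\<close> a natural number.\<close>

type_synonym qpoly = "(nat \<Rightarrow>\<^sub>0 nat) \<Rightarrow>\<^sub>0 rat"
type_synonym ratfun = "qpoly fract"

definition poly_vars :: "qpoly \<Rightarrow> nat set" where
  "poly_vars p = (\<Union>m\<in>Poly_Mapping.keys p. Poly_Mapping.keys m)"

definition rconst :: "rat \<Rightarrow> ratfun" where
  "rconst c = Fract (Poly_Mapping.single 0 c) 1"

definition u :: "nat \<Rightarrow> ratfun" where
  "u k = Fract (Poly_Mapping.single (Poly_Mapping.single k 1) 1) 1"

definition poly_eval :: "(nat \<Rightarrow> ratfun) \<Rightarrow> qpoly \<Rightarrow> ratfun" where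
  "poly_eval \<sigma> p = (\<Sum>m\<in>Poly_Mapping.keys p. rconst (Poly_Mapping.lookup p m) *
                      (\<Prod>k\<in>Poly_Mapping.keys m. \<sigma> k ^ Poly_Mapping.lookup m k))"

text \<open>
  The substitution \<open>u\<^sub>k := \<sigma> k\<close> in \<open>f = p / q\<close>.  The value does not depend on the representation;
  it is unspecified only if the denominator vanishes for every representation, which does not
  happen when the \<open>\<sigma> k\<close> for the variables of \<open>f\<close> are linearly independent linear forms.
\<close>

definition rsubst :: "(nat \<Rightarrow> ratfun) \<Rightarrow> ratfun \<Rightarrow> ratfun" where
  "rsubst \<sigma> f = (THE h. \<exists>p q. q \<noteq> 0 \<and> f = Fract p q \<and> poly_eval \<sigma> q \<noteq> 0 \<and>
                              h = poly_eval \<sigma> p / poly_eval \<sigma> q)"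


section \<open>The operad Mould\<close>

definition Mould :: "ratfun ns_operad" where
  "Mould =
     \<lparr> op_space = (\<lambda>n. {f. \<exists>p q. q \<noteq> 0 \<and> f = Fract p q \<and>
                              poly_vars p \<subseteq> {1..n} \<and> poly_vars q \<subseteq> {1..n}}),
       op_add = (\<lambda>n f g. f + g),
       op_scale = (\<lambda>n c f. rconst c * f),
       op_unit = 1 / u 1,
       op_comp = (\<lambda>m n i f g.
         let w = (\<Sum>k = i..i + n - 1. u k)
         in w * rsubst (\<lambda>k. if k < i then u k else if k = i then w else u (k + n - 1)) f
              * rsubst (\<lambda>k. u (i + k - 1)) g) \<rparr>"

end

theory Submission
  imports Defs
begin

text \<open>
  Write \<open>S(I)\<close> for the sum of the variables with index in \<open>I\<close>.  The morphism sends a composite of the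
  generators, that is a labelled binary tree with \<open>n\<close> leaves, to a product of quotients of such sums
  (\<open>tree_value\<close>): a leaf in position \<open>k\<close> contributes \<open>1 / u\<^sub>k\<close>, a vertex \<open>L\<close> the quotient of the sum
  over its right leaves by the sum over all its leaves, a vertex \<open>R\<close> the same with its left leaves.
  This value is compatible with grafting (\<open>tree_value_graft\<close>) and satisfies the three dendriform
  relations (\<open>free_value_dend_rel\<close>), hence descends to a morphism of operads.  It is the only one with
  the given values on \<open>L\<close> and \<open>R\<close>, because \<open>Dend\<close> is generated by these two elements.

  Injectivity rests on the elements of \<open>Dend(n)\<close> indexed by the binary trees with \<open>n\<close> inner vertices,
  \<open>A \<or> B = (A \<succ> Y) \<prec> B = A \<succ> (Y \<prec> B)\<close>.  They span \<open>Dend(n)\<close>: the dendriform relations rewrite the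
  products \<open>x \<succ> y\<close> and \<open>x \<prec> y\<close> of two of them in terms of products of smaller total size
  (\<open>spanned_by_join_basis_trees\<close>).  The image of the tree \<open>T\<close> is the product of \<open>1 / S(I)\<close> over all
  inner vertices of \<open>T\<close>, where \<open>I\<close> is the interval of the vertices of the subtree in in-order
  (\<open>tree_value_basis_tree\<close>).  These functions are linearly independent (\<open>tree_mould_independent\<close>):
  after multiplication by the common factor \<open>u\<^sub>1 + \<dots> + u\<^sub>n\<close>, the summand of a tree whose root is the
  \<open>k\<close>-th vertex does not involve \<open>u\<^sub>k\<close>, whereas that of a tree with root at a vertex \<open>j < k\<close> tends to
  \<open>0\<close> for \<open>u\<^sub>k \<longlongrightarrow> \<infinity>\<close>.  Treating the largest \<open>k\<close> first, one isolates the trees with root at \<open>k\<close>;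
  their summands are products of functions of separate sets of variables, so induction applies.
  That the spanning elements form a basis is not needed beforehand; it follows.

  Substitution into rational functions and evaluation at real points are both instances of a
  relation \<open>specializes\<close>, which is preserved by the field operations and determines its value; hence
  \<open>rsubst\<close> is computed without choosing representations of fractions.
\<close>

section \<open>Evaluation of polynomials and specialization of rational functions\<close>

text \<open>
  Polynomials with rational coefficients are evaluated in the field of rational functions as well as
  in the reals, so the map on coefficients is a parameter.
\<close>

locale ring_morphism =
  fixes h :: "'a::comm_ring_1 \<Rightarrow> 'b::comm_ring_1"
  assumes add: "h (a + b) = h a + h b"
    and mult: "h (a * b) = h a * h b"
    and one: "h 1 = 1"
begin

lemma zero: "h 0 = 0"
  using add[of 0 0] by simp

end

text \<open>
  Additive maps on finitely supported functions are determined by their values on one-point functions.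
\<close>

lemma additive_eqI:
  fixes F G :: "('a \<Rightarrow>\<^sub>0 'b::comm_monoid_add) \<Rightarrow> 'c::ab_group_add"
  assumes F: "\<And>f g. F (f + g) = F f + F g" and G: "\<And>f g. G (f + g) = G f + G g"
    and single: "\<And>k c. F (Poly_Mapping.single k c) = G (Poly_Mapping.single k c)"
  shows "F f = G f"
proof (induction f rule: update_induct)
  case const
  show ?case using F[of 0 0] G[of 0 0] by simp
next
  case (update f a b)
  have "Poly_Mapping.update a b f = Poly_Mapping.single a b + f"
    using update(1) by (intro poly_mapping_eqI)
      (auto simp: lookup_update lookup_add lookup_single when_def in_keys_iff)
  then show ?case using update by (simp add: F G single)
qed

lemma sum_of_singles: "(\<Sum>k\<in>Poly_Mapping.keys f. Poly_Mapping.single k (Poly_Mapping.lookup f k)) = f"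
  by (intro poly_mapping_eqI)
    (auto simp: lookup_sum lookup_single when_def sum.delta in_keys_iff)

text \<open>
  The value of the monomial with exponents \<open>m\<close> at \<open>\<sigma>\<close>.
\<close>

definition monom_value :: "(nat \<Rightarrow> 'b::comm_ring_1) \<Rightarrow> (nat \<Rightarrow>\<^sub>0 nat) \<Rightarrow> 'b" where
  "monom_value \<sigma> m = (\<Prod>k\<in>Poly_Mapping.keys m. \<sigma> k ^ Poly_Mapping.lookup m k)"

lemma monom_value_superset:
  assumes "finite S" "Poly_Mapping.keys m \<subseteq> S"
  shows "monom_value \<sigma> m = (\<Prod>k\<in>S. \<sigma> k ^ Poly_Mapping.lookup m k)"
  unfolding monom_value_def
  by (rule prod.mono_neutral_left) (use assms in \<open>auto simp: in_keys_iff\<close>)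

lemma monom_value_add: "monom_value \<sigma> (m + m') = monom_value \<sigma> m * monom_value \<sigma> m'"
proof -
  let ?S = "Poly_Mapping.keys m \<union> Poly_Mapping.keys m'"
  have "monom_value \<sigma> (m + m') = (\<Prod>k\<in>?S. \<sigma> k ^ Poly_Mapping.lookup (m + m') k)"
    by (rule monom_value_superset) (use keys_add[of m m'] in auto)
  also have "\<dots> = monom_value \<sigma> m * monom_value \<sigma> m'"
    by (simp add: monom_value_superset[of ?S] lookup_add power_add prod.distrib)
  finally show ?thesis .
qed

text \<open>The value of a polynomial at \<open>\<sigma>\<close>, the coefficients being mapped by \<open>h\<close>.\<close>

definition peval :: "(rat \<Rightarrow> 'b) \<Rightarrow> (nat \<Rightarrow> 'b::comm_ring_1) \<Rightarrow> qpoly \<Rightarrow> 'b" where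
  "peval h \<sigma> p =
     (\<Sum>m\<in>Poly_Mapping.keys p. h (Poly_Mapping.lookup p m) * monom_value \<sigma> m)"

lemma poly_eval_eq_peval: "poly_eval \<sigma> = peval rconst \<sigma>"
  by (rule ext) (simp add: poly_eval_def peval_def monom_value_def)

lemma peval_single:
  assumes "ring_morphism h"
  shows "peval h \<sigma> (Poly_Mapping.single m c) = h c * monom_value \<sigma> m"
proof -
  interpret ring_morphism h by fact
  show ?thesis by (simp add: peval_def zero)
qed

lemma ring_morphism_peval:
  assumes "ring_morphism h"
  shows "ring_morphism (peval h \<sigma>)"
proof -
  interpret ring_morphism h by fact
  note single = peval_single[OF assms]
  have add': "peval h \<sigma> (p + q) = peval h \<sigma> p + peval h \<sigma> q" for p q
    unfolding peval_def
    by (rule setsum_keys_plus_distrib) (simp_all add: zero add algebra_simps)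
  have mult_single: "peval h \<sigma> (Poly_Mapping.single m a * q) = peval h \<sigma> (Poly_Mapping.single m a) * peval h \<sigma> q"
    for m a q
    by (rule additive_eqI[of "\<lambda>q. peval h \<sigma> (Poly_Mapping.single m a * q)"])
      (simp_all add: add' distrib_left Poly_Mapping.mult_single single monom_value_add mult)
  show ?thesis
  proof
    show "peval h \<sigma> (p * q) = peval h \<sigma> p * peval h \<sigma> q" for p q
      by (rule additive_eqI[of "\<lambda>p. peval h \<sigma> (p * q)"])
        (simp_all add: add' distrib_right mult_single)
    show "peval h \<sigma> 1 = 1"
      using single[of \<sigma> 0 1] by (simp add: one monom_value_def)
  qed (fact add')
qed

text \<open>
  \<open>specializes e f x\<close>: the ring morphism \<open>e\<close>, extended to those fractions that have a representation
  whose denominator is not mapped to \<open>0\<close>, is defined at \<open>f\<close> and takes the value \<open>x\<close> there.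
\<close>

definition specializes :: "('a::idom \<Rightarrow> 'b::field) \<Rightarrow> 'a fract \<Rightarrow> 'b \<Rightarrow> bool" where
  "specializes e f x \<longleftrightarrow> (\<exists>p q. q \<noteq> 0 \<and> f = Fract p q \<and> e q \<noteq> 0 \<and> x = e p / e q)"

lemma rsubst_eq_The: "rsubst \<sigma> f = (THE x. specializes (poly_eval \<sigma>) f x)"
  by (simp add: rsubst_def specializes_def)

context
  fixes e :: "'a::idom \<Rightarrow> 'b::field"
  assumes e: "ring_morphism e"
begin

interpretation ring_morphism e by (fact e)

lemma specializes_unique:
  assumes "specializes e f x" "specializes e f y"
  shows "x = y"
proof -
  from assms obtain p q p' q' where
    *: "q \<noteq> 0" "f = Fract p q" "e q \<noteq> 0" "x = e p / e q"
       "q' \<noteq> 0" "f = Fract p' q'" "e q' \<noteq> 0" "y = e p' / e q'"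
    unfolding specializes_def by blast
  then have "p * q' = p' * q" by (simp add: eq_fract)
  then have "e p * e q' = e p' * e q" by (metis mult)
  then show ?thesis by (simp only: *(4,8) frac_eq_eq[OF *(3,7)])
qed

lemma specializes_Fract: "specializes e (Fract p 1) (e p)"
  unfolding specializes_def by (intro exI[of _ p] exI[of _ 1]) (simp add: one)

lemma specializes_add:
  assumes "specializes e f x" "specializes e g y"
  shows "specializes e (f + g) (x + y)"
proof -
  from assms obtain p q p' q' where
    *: "q \<noteq> 0" "f = Fract p q" "e q \<noteq> 0" "x = e p / e q"
       "q' \<noteq> 0" "g = Fract p' q'" "e q' \<noteq> 0" "y = e p' / e q'"
    unfolding specializes_def by blast
  then show ?thesis unfolding specializes_def
    by (intro exI[of _ "p * q' + p' * q"] exI[of _ "q * q'"]) (simp add: mult add field_simps)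
qed

lemma specializes_mult:
  assumes "specializes e f x" "specializes e g y"
  shows "specializes e (f * g) (x * y)"
proof -
  from assms obtain p q p' q' where
    *: "q \<noteq> 0" "f = Fract p q" "e q \<noteq> 0" "x = e p / e q"
       "q' \<noteq> 0" "g = Fract p' q'" "e q' \<noteq> 0" "y = e p' / e q'"
    unfolding specializes_def by blast
  then show ?thesis unfolding specializes_def
    by (intro exI[of _ "p * p'"] exI[of _ "q * q'"]) (simp add: mult)
qed

lemma specializes_divide:
  assumes "specializes e f x" "specializes e g y" "y \<noteq> 0"
  shows "specializes e (f / g) (x / y)"
proof -
  from assms obtain p q p' q' where
    *: "q \<noteq> 0" "f = Fract p q" "e q \<noteq> 0" "x = e p / e q"
       "q' \<noteq> 0" "g = Fract p' q'" "e q' \<noteq> 0" "y = e p' / e q'"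
    unfolding specializes_def by blast
  with \<open>y \<noteq> 0\<close> have "e p' \<noteq> 0" "p' \<noteq> 0" using zero by auto
  with * show ?thesis unfolding specializes_def
    by (intro exI[of _ "p * q'"] exI[of _ "q * p'"]) (simp add: mult)
qed

lemma specializes_0: "specializes e 0 0"
  using specializes_Fract[of 0] by (simp add: fract_collapse zero)

lemma specializes_1: "specializes e 1 1"
  using specializes_Fract[of 1] by (simp add: fract_collapse one)

lemma specializes_sum:
  assumes "\<And>i. i \<in> I \<Longrightarrow> specializes e (f i) (x i)"
  shows "specializes e (sum f I) (sum x I)"
  using assms by (induction I rule: infinite_finite_induct)
    (simp_all add: specializes_0 specializes_add)

lemma specializes_sum_list:
  assumes "list_all2 (specializes e) fs xs"
  shows "specializes e (sum_list fs) (sum_list xs)"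
  using assms by (induction rule: list_all2_induct) (simp_all add: specializes_0 specializes_add)

end

lemma ring_morphism_rconst: "ring_morphism rconst"
  by unfold_locales (simp_all add: rconst_def single_add mult_single One_fract_def)

lemmas ring_morphism_poly_eval =
  ring_morphism_peval[OF ring_morphism_rconst, folded poly_eval_eq_peval]

lemma ring_morphism_of_rat: "ring_morphism (of_rat :: rat \<Rightarrow> real)"
  by unfold_locales (simp_all add: of_rat_add of_rat_mult)

lemma rsubst_eqI:
  assumes "specializes (poly_eval \<sigma>) f x"
  shows "rsubst \<sigma> f = x"
  unfolding rsubst_eq_The
  using assms specializes_unique[OF ring_morphism_poly_eval] by blast

lemma specializes_rconst:
  assumes "ring_morphism h"
  shows "specializes (peval h \<sigma>) (rconst c) (h c)"
  using specializes_Fract[OF ring_morphism_peval[OF assms], of \<sigma> "Poly_Mapping.single 0 c"]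
  by (simp add: rconst_def peval_single[OF assms] monom_value_def)

lemma specializes_u:
  assumes "ring_morphism h"
  shows "specializes (peval h \<sigma>) (u k) (\<sigma> k)"
proof -
  interpret ring_morphism h by fact
  show ?thesis
    using specializes_Fract[OF ring_morphism_peval[OF assms], of \<sigma> "Poly_Mapping.single (Poly_Mapping.single k 1) 1"]
    by (simp add: u_def peval_single[OF assms] monom_value_def one)
qed

section \<open>Values of trees\<close>

text \<open>
  The image of a composite of generators, as a function of the list of the values of the variables,
  one for each leaf.  Only lists of length \<^term>\<open>size1 t\<close> matter; on these the first equation is the
  unit \<open>1 / u\<^sub>1\<close>, and the second one is \<open>\<psi>(x)\<close> with the two subtrees plugged in.  If these have the
  variable sums \<open>S\<^sub>l\<close> and \<open>S\<^sub>r\<close>, composition multiplies by \<open>S\<^sub>l S\<^sub>r\<close>, and one of these two factors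
  cancels in \<open>\<psi>(L) = 1 / (S\<^sub>l (S\<^sub>l + S\<^sub>r))\<close> or \<open>\<psi>(R) = 1 / ((S\<^sub>l + S\<^sub>r) S\<^sub>r)\<close>.
\<close>

fun tree_value :: "dend_gen tree \<Rightarrow> 'a::field list \<Rightarrow> 'a" where
  "tree_value \<langle>\<rangle> xs = 1 / sum_list xs"
| "tree_value \<langle>l, x, r\<rangle> xs =
     (case x of L \<Rightarrow> sum_list (drop (size1 l) xs) | R \<Rightarrow> sum_list (take (size1 l) xs)) / sum_list xs *
     tree_value l (take (size1 l) xs) * tree_value r (drop (size1 l) xs)"

lemma size1_graft: "1 \<le> i \<Longrightarrow> i \<le> size1 s \<Longrightarrow> size1 (graft i s t) = size1 s + size1 t - 1"
  by (induction i s t rule: graft.induct) (auto simp: size1_size)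

text \<open>
  The composition rule of \<open>Mould\<close>: the variable \<open>u\<^sub>i\<close> of the outer function becomes the sum of the
  variables of the inner one, and this sum is also an extra factor.  It cancels the factor \<open>1 / u\<^sub>i\<close>
  of the leaf that is replaced.
\<close>

lemma tree_value_graft:
  assumes "size1 s = length xs + 1 + length zs" "size1 t = length ys" "sum_list ys \<noteq> (0::'a::field)"
  shows "tree_value (graft (length xs + 1) s t) (xs @ ys @ zs) =
    sum_list ys * tree_value s (xs @ [sum_list ys] @ zs) * tree_value t ys"
  using assms(1)
proof (induction s arbitrary: xs zs)
  case Leaf
  then show ?case using assms by simp
next
  case (Node l x r)
  show ?case
  proof (cases "length xs + 1 \<le> size1 l")
    case True
    define k where "k = size1 l - (length xs + 1)"
    have k: "size1 l = length xs + 1 + length (take k zs)" "k \<le> length zs"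
      using True Node.prems size1_ge0[of r] by (auto simp: k_def)
    have g: "size1 (graft (length xs + 1) l t) = length xs + length ys + k"
      using True assms(2) by (simp add: size1_graft k_def)
    have l: "size1 l = length xs + Suc k" using True by (simp add: k_def)
    show ?thesis
      using True Node.IH(1)[OF k(1)] g
      by (simp add: l add.assoc split: dend_gen.split)
  next
    case False
    define ws where "ws = take (size1 l) xs"
    define vs where "vs = drop (size1 l) xs"
    have xs: "xs = ws @ vs" and lw: "size1 l = length ws"
      using False by (simp_all add: ws_def vs_def)
    have r: "size1 r = length vs + 1 + length zs" using Node.prems by (simp add: xs lw)
    show ?thesis
      using False Node.IH(2)[OF r]
      by (simp add: xs lw add.assoc split: dend_gen.split)
  qed
qed

text \<open>
  No nonempty list of entries of \<open>xs\<close>, repetitions allowed, has sum \<open>0\<close>; this keeps all denominators away from \<open>0\<close>.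
\<close>

definition zero_sum_free :: "'a::comm_monoid_add list \<Rightarrow> bool" where
  "zero_sum_free xs \<longleftrightarrow> (\<forall>zs. zs \<noteq> [] \<and> set zs \<subseteq> set xs \<longrightarrow> sum_list zs \<noteq> 0)"

lemma zero_sum_free_sum: "zero_sum_free xs \<Longrightarrow> xs \<noteq> [] \<Longrightarrow> sum_list xs \<noteq> 0"
  by (simp add: zero_sum_free_def)

lemma zero_sum_free_subset: "zero_sum_free xs \<Longrightarrow> set ys \<subseteq> set xs \<Longrightarrow> zero_sum_free ys"
  unfolding zero_sum_free_def by blast

lemma zero_sum_free_take_drop:
  "zero_sum_free xs \<Longrightarrow> zero_sum_free (take n xs)" "zero_sum_free xs \<Longrightarrow> zero_sum_free (drop n xs)"
  by (erule zero_sum_free_subset, simp add: set_take_subset set_drop_subset)+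

lemma sum_list_positive:
  "xs \<noteq> [] \<Longrightarrow> \<forall>x\<in>set xs. 0 < (x::real) \<Longrightarrow> 0 < sum_list xs"
  by (induction xs) (auto intro: add_pos_nonneg sum_list_nonneg order.strict_implies_order)

lemma zero_sum_free_positive: "\<forall>x\<in>set xs. 0 < (x::real) \<Longrightarrow> zero_sum_free xs"
  unfolding zero_sum_free_def
  by (metis less_irrefl subset_code(1) sum_list_positive)

text \<open>
  Tree values commute with substitution and with evaluation at points.
\<close>

lemma specializes_tree_value:
  assumes e: "ring_morphism e"
    and "list_all2 (specializes e) fs xs" "zero_sum_free xs" "length xs = size1 t"
  shows "specializes e (tree_value t fs) (tree_value t xs)"
  using assms(2-)
proof (induction t arbitrary: fs xs)
  case Leaf
  then have "sum_list xs \<noteq> 0" by (intro zero_sum_free_sum) auto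
  then show ?case using Leaf
    by (auto intro!: specializes_divide[OF e] specializes_1[OF e] specializes_sum_list[OF e])
next
  case (Node l x r)
  let ?n = "size1 l"
  have nz: "sum_list xs \<noteq> 0"
    using Node.prems size1_ge0[of l] by (intro zero_sum_free_sum) (auto simp del: size1_ge0)
  have t: "list_all2 (specializes e) (take ?n fs) (take ?n xs)"
    and d: "list_all2 (specializes e) (drop ?n fs) (drop ?n xs)"
    using Node.prems by (auto intro: list_all2_takeI list_all2_dropI)
  have "specializes e (case x of L \<Rightarrow> sum_list (drop ?n fs) | R \<Rightarrow> sum_list (take ?n fs))
          (case x of L \<Rightarrow> sum_list (drop ?n xs) | R \<Rightarrow> sum_list (take ?n xs))"
    using specializes_sum_list[OF e t] specializes_sum_list[OF e d] by (simp split: dend_gen.split)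
  then show ?case
    using nz Node.prems Node.IH[OF t] Node.IH[OF d] 
    by (auto intro!: specializes_divide[OF e] specializes_mult[OF e] specializes_sum_list[OF e]
        Node.IH t d zero_sum_free_take_drop)
qed

section \<open>The basis of the dendriform operad and its image\<close>

text \<open>
  The composite of generators for the basis element \<open>A \<or> B = A \<succ> (Y \<prec> B)\<close>, and its right factor
  \<open>Y \<prec> B\<close>; a factor with an empty subtree is omitted.  A binary tree with \<open>n\<close> inner vertices is a
  \<^typ>\<open>unit tree\<close> of size \<open>n\<close>, the empty tree being the one with a single leaf.  The latter has no
  basis element, and \<^term>\<open>basis_tree \<langle>\<rangle>\<close> is a default value.
\<close>

fun basis_tree :: "unit tree \<Rightarrow> dend_gen tree"
  and right_factor :: "unit tree \<Rightarrow> dend_gen tree" where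
  "basis_tree \<langle>\<rangle> = \<langle>\<rangle>"
| "basis_tree \<langle>A, _, B\<rangle> =
     (if A = \<langle>\<rangle> then right_factor B else \<langle>basis_tree A, L, right_factor B\<rangle>)"
| "right_factor B = (if B = \<langle>\<rangle> then \<langle>\<rangle> else \<langle>\<langle>\<rangle>, R, basis_tree B\<rangle>)"

lemma size1_basis_tree:
  "T \<noteq> \<langle>\<rangle> \<Longrightarrow> size1 (basis_tree T) = size T"
  "size1 (right_factor B) = Suc (size B)"
  by (induction T and B rule: basis_tree_right_factor.induct) auto

text \<open>
  The product, over the inner vertices of a binary tree, of the inverse of the sum of the variables of
  the vertices below it (inclusive); the vertices are numbered in in-order.
\<close>

fun tree_mould :: "unit tree \<Rightarrow> 'a::field list \<Rightarrow> 'a" where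
  "tree_mould \<langle>\<rangle> xs = 1"
| "tree_mould \<langle>A, _, B\<rangle> xs =
     1 / sum_list xs * tree_mould A (take (size A) xs) * tree_mould B (drop (Suc (size A)) xs)"

text \<open>
  The factor of the vertex \<open>L\<close> in \<open>A \<succ> (Y \<prec> B)\<close> is the quotient of the sum for \<open>Y \<prec> B\<close> by the total
  sum; the numerator cancels the denominator of the vertex \<open>R\<close>, whose own numerator cancels the
  factor of the leaf \<open>Y\<close>.
\<close>

lemma tree_value_basis_tree:
  "T \<noteq> \<langle>\<rangle> \<Longrightarrow> length xs = size T \<Longrightarrow> zero_sum_free xs \<Longrightarrow>
     tree_value (basis_tree T) xs = tree_mould T (xs :: 'a::field list)"
  "length ys = Suc (size B) \<Longrightarrow> zero_sum_free ys \<Longrightarrow>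
     tree_value (right_factor B) ys = 1 / sum_list ys * tree_mould B (tl (ys :: 'a list))"
proof (induction T and B arbitrary: xs and ys rule: basis_tree_right_factor.induct)
  case (2 A v B)
  show ?case
  proof (cases "A = \<langle>\<rangle>")
    case True
    then show ?thesis using 2(1)[of xs] 2(4-) by (simp add: drop_Suc)
  next
    case False
    have ne: "sum_list (drop (size A) xs) \<noteq> 0"
      using 2(5,6) by (intro zero_sum_free_sum zero_sum_free_take_drop) auto
    have "tree_value (right_factor B) (drop (size A) xs) =
        1 / sum_list (drop (size A) xs) * tree_mould B (drop (Suc (size A)) xs)"
      using False 2(3)[of "drop (size A) xs"] 2(5,6)
      by (simp add: zero_sum_free_take_drop tl_drop drop_Suc)
    moreover have "tree_value (basis_tree A) (take (size A) xs) = tree_mould A (take (size A) xs)"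
      using False 2(2)[of "take (size A) xs"] 2(5,6)
      by (simp add: zero_sum_free_take_drop)
    ultimately show ?thesis
      using False ne by (simp add: size1_basis_tree)
  qed
next
  case (3 B)
  obtain y zs where ys: "ys = y # zs" using 3(2) by (cases ys) auto
  show ?case
  proof (cases "B = \<langle>\<rangle>")
    case True
    then show ?thesis using 3(2) ys by simp
  next
    case False
    have "y \<noteq> 0" using zero_sum_free_sum[OF zero_sum_free_subset[OF 3(3), of "[y]"]] ys by simp
    moreover have "zero_sum_free zs"
      using zero_sum_free_subset[OF 3(3), of zs] ys by auto
    ultimately show ?thesis using False 3(1)[of zs] 3(2) ys by simp
  qed
qed simp

text \<open>Decomposition of the trees with \<open>n + 1\<close> vertices by the number \<open>k\<close> of vertices left of the root.\<close>

lemma bij_betw_unit_trees: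
  "bij_betw (\<lambda>(k, A, B). \<langle>A, (), B\<rangle>)
     (SIGMA k:{..n}. {A. size A = k} \<times> {B. size B = n - k}) {T. size T = Suc n}"
  unfolding bij_betw_def
proof
  show "(\<lambda>(k, A, B). \<langle>A, (), B\<rangle>) ` (SIGMA k:{..n}. {A. size A = k} \<times> {B. size B = n - k}) =
    {T. size T = Suc n}"
  proof (intro equalityI subsetI)
    fix T :: "unit tree" assume "T \<in> {T. size T = Suc n}"
    then obtain A B where T: "T = \<langle>A, (), B\<rangle>" and n: "size A + size B = n"
      by (cases T) auto
    show "T \<in> (\<lambda>(k, A, B). \<langle>A, (), B\<rangle>) ` (SIGMA k:{..n}. {A. size A = k} \<times> {B. size B = n - k})"
      using n by (intro image_eqI[of _ _ "(size A, A, B)"]) (auto simp: T)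
  qed auto
qed (auto simp: inj_on_def)

lemma finite_unit_trees: "finite {T :: unit tree. size T = n}"
proof (induction n rule: less_induct)
  case (less n)
  show ?case
  proof (cases n)
    case (Suc m)
    have "finite (SIGMA k:{..m}. {A :: unit tree. size A = k} \<times> {B :: unit tree. size B = m - k})"
      using less Suc by (intro finite_SigmaI finite_cartesian_product) auto
    then show ?thesis
      using bij_betw_finite[OF bij_betw_unit_trees[of m]] Suc by simp
  qed simp
qed

lemma sum_unit_trees:
  "(\<Sum>T | size T = Suc n. g T) =
     (\<Sum>k\<le>n. \<Sum>A | size A = k. \<Sum>B | size B = n - k. g \<langle>A, (), B\<rangle>)"
proof -
  have "(\<Sum>T | size T = Suc n. g T) =
      (\<Sum>(k, A, B)\<in>(SIGMA k:{..n}. {A. size A = k} \<times> {B. size B = n - k}). g \<langle>A, (), B\<rangle>)"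
    using sum.reindex_bij_betw[OF bij_betw_unit_trees[of n], of g]
    by (simp add: case_prod_unfold)
  also have "\<dots> = (\<Sum>k\<le>n. \<Sum>(A, B)\<in>{A. size A = k} \<times> {B. size B = n - k}. g \<langle>A, (), B\<rangle>)"
    by (subst sum.Sigma[symmetric]) (auto intro!: finite_cartesian_product finite_unit_trees)
  also have "\<dots> = (\<Sum>k\<le>n. \<Sum>A | size A = k. \<Sum>B | size B = n - k. g \<langle>A, (), B\<rangle>)"
    by (simp add: sum.cartesian_product)
  finally show ?thesis .
qed

text \<open>
  The factor of the root tends to \<open>0\<close>, and every other factor converges.
\<close>

lemma tendsto_tree_mould:
  assumes "size T = length ps + Suc (length qs)"
  shows "((\<lambda>t. tree_mould T (ps @ t # qs)) \<longlongrightarrow> (0::real)) at_top"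
  using assms
proof (induction T arbitrary: ps qs)
  case (Node A v B)
  have "filterlim (\<lambda>t::real. (sum_list ps + sum_list qs) + t) at_top at_top"
    by (rule filterlim_tendsto_add_at_top[OF tendsto_const filterlim_ident])
  then have sum: "((\<lambda>t. 1 / sum_list (ps @ t # qs)) \<longlongrightarrow> 0) at_top"
    using tendsto_inverse_0_at_top
    by (simp add: inverse_eq_divide add.assoc add.left_commute add.commute)
  consider "size A < length ps" | "size A = length ps" | "size A > length ps" by linarith
  then show ?case
  proof cases
    case 1
    then have "((\<lambda>t. tree_mould B (drop (Suc (size A)) ps @ t # qs)) \<longlongrightarrow> 0) at_top"
      using Node.prems by (intro Node.IH) auto
    from tendsto_mult[OF tendsto_mult[OF sum tendsto_const] this] 1 show ?thesis by simp
  next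
    case 2
    from tendsto_mult[OF tendsto_mult[OF sum tendsto_const] tendsto_const] 2 show ?thesis by simp
  next
    case 3
    define k where "k = size A - Suc (length ps)"
    have A: "size A = length ps + Suc k" using 3 by (simp add: k_def)
    have "((\<lambda>t. tree_mould A (ps @ t # take k qs)) \<longlongrightarrow> 0) at_top"
      using Node.prems A by (intro Node.IH) auto
    from tendsto_mult[OF tendsto_mult[OF sum this] tendsto_const] A show ?thesis by simp
  qed
qed simp

text \<open>
  Linear independence of the functions \<^const>\<open>tree_mould\<close>, already on lists of positive reals.
\<close>

lemma tree_mould_independent:
  fixes c :: "unit tree \<Rightarrow> real"
  assumes "\<And>xs. length xs = n \<Longrightarrow> \<forall>x\<in>set xs. 0 < x \<Longrightarrow>
    (\<Sum>T | size T = n. c T * tree_mould T xs) = 0"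
  assumes "size T = n"
  shows "c T = 0"
  using assms
proof (induction n arbitrary: c T rule: less_induct)
  case (less n)
  note outer_IH = less.IH
  show ?case
  proof (cases n)
    case 0
    have "{T :: unit tree. size T = 0} = {\<langle>\<rangle>}" by auto
    then show ?thesis using less.prems(1)[of "[]"] less.prems(2) 0 by simp
  next
    case (Suc m)
    \<comment> \<open>The part of the sum with \<open>k\<close> vertices left of the root, without the factor of the root.\<close>
    define F where "F xs k = (\<Sum>A | size A = k. \<Sum>B | size B = m - k. c \<langle>A, (), B\<rangle> *
      (tree_mould A (take k xs) * tree_mould B (drop (Suc k) xs)))" for xs k
    have sumF: "(\<Sum>k\<le>m. F xs k) = 0" if xs: "length xs = n" "\<forall>x\<in>set xs. 0 < x" for xs
    proof -
      have "sum_list xs > 0" using xs Suc by (intro sum_list_positive) auto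
      moreover have "1 / sum_list xs * (\<Sum>k\<le>m. F xs k) = (\<Sum>T | size T = n. c T * tree_mould T xs)"
        unfolding F_def Suc sum_unit_trees sum_distrib_left
        by (auto intro!: sum.cong simp: mult_ac)
      ultimately show ?thesis using less.prems(1)[OF xs] by simp
    qed
    have *: "c \<langle>A, (), B\<rangle> = 0" if "size A = k" "size B = m - k" "k \<le> m" for A B k
      \<comment> \<open>Roots further to the right come first.\<close>
      using that
    proof (induction "m - k" arbitrary: k A B rule: less_induct)
      case (less k)
      have bigger: "c \<langle>A', (), B'\<rangle> = 0" if "k < j" "j \<le> m" "size A' = j" "size B' = m - j" for A' B' j
        using less.hyps[of j A' B'] that by linarith
      have sumk: "(\<Sum>A | size A = k. \<Sum>B | size B = m - k.
          c \<langle>A, (), B\<rangle> * (tree_mould A ys * tree_mould B zs)) = 0"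
        if len: "length ys = k" "length zs = m - k"
          and pos: "\<forall>x\<in>set ys. 0 < x" "\<forall>x\<in>set zs. 0 < x" for ys zs
      proof -
        define K where "K = (\<Sum>A | size A = k. \<Sum>B | size B = m - k.
          c \<langle>A, (), B\<rangle> * (tree_mould A ys * tree_mould B zs))"
        \<comment> \<open>Limit of each part as the variable of the root vertex tends to infinity, the others being fixed.\<close>
        have "((\<lambda>t. F (ys @ t # zs) j) \<longlongrightarrow> (if j = k then K else 0)) at_top" if "j \<le> m" for j
        proof -
          consider "j < k" | "j = k" | "j > k" by linarith
          then show ?thesis
          proof cases
            case 1
            have "((\<lambda>t. tree_mould B (drop (Suc j) ys @ t # zs)) \<longlongrightarrow> 0) at_top"
              if "size B = m - j" for B
              using that 1 len less.prems by (intro tendsto_tree_mould) auto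
            then show ?thesis
              using 1 len unfolding F_def
              by (auto intro!: tendsto_null_sum tendsto_mult_right_zero)
          next
            case 2
            then show ?thesis unfolding F_def K_def using len by simp
          next
            case 3
            then show ?thesis unfolding F_def using bigger that by simp
          qed
        qed
        then have "((\<lambda>t. \<Sum>j\<le>m. F (ys @ t # zs) j) \<longlongrightarrow> (\<Sum>j\<le>m. if j = k then K else 0)) at_top"
          by (intro tendsto_sum) auto
        moreover have "\<forall>\<^sub>F t in at_top. (\<Sum>j\<le>m. F (ys @ t # zs) j) = 0"
          using eventually_gt_at_top[of 0]
          by eventually_elim (use len pos less.prems Suc in \<open>auto intro!: sumF\<close>)
        ultimately have "((\<lambda>t::real. 0) \<longlongrightarrow> (\<Sum>j\<le>m. if j = k then K else 0)) at_top"
          using tendsto_cong by fast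
        then have "(\<Sum>j\<le>m. if j = k then K else 0) = 0"
          using tendsto_unique[OF trivial_limit_at_top_linorder tendsto_const] by metis
        then show ?thesis using less.prems(3) by (simp add: K_def)
      qed
      \<comment> \<open>The variables \<open>ys\<close> and \<open>zs\<close> are separated: independence is applied to each in turn.\<close>
      have "(\<Sum>B | size B = m - k. c \<langle>A, (), B\<rangle> * tree_mould B zs) = 0"
        if zs: "length zs = m - k" "\<forall>x\<in>set zs. 0 < x" for zs
      proof -
        have "k < n" using Suc less.prems by simp
        moreover have "(\<Sum>A | size A = k. (\<Sum>B | size B = m - k. c \<langle>A, (), B\<rangle> * tree_mould B zs) *
          tree_mould A ys) = 0" if "length ys = k" "\<forall>x\<in>set ys. 0 < x" for ys
          using sumk[OF that(1) zs(1) that(2) zs(2)] by (simp add: sum_distrib_right sum_distrib_left mult_ac)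
        ultimately show ?thesis
          using outer_IH[of k "\<lambda>A. \<Sum>B | size B = m - k. c \<langle>A, (), B\<rangle> * tree_mould B zs"] less.prems(1)
          by blast
      qed
      moreover have "m - k < n" using Suc by simp
      ultimately show ?case
        using outer_IH[of "m - k" "\<lambda>B. c \<langle>A, (), B\<rangle>"] less.prems(2) by blast
    qed
    obtain A B where "T = \<langle>A, (), B\<rangle>" "size A + size B = m"
      using less.prems(2) Suc by (cases T) auto
    then show ?thesis using * by auto
  qed
qed

section \<open>The free operad\<close>

text \<open>
  The bilinear extension of a binary operation on basis elements.
\<close>

definition bilinear_ext :: "('a \<Rightarrow> 'b \<Rightarrow> 'c) \<Rightarrow> ('a \<Rightarrow>\<^sub>0 rat) \<Rightarrow> ('b \<Rightarrow>\<^sub>0 rat) \<Rightarrow> 'c \<Rightarrow>\<^sub>0 rat" where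
  "bilinear_ext b f g = (\<Sum>s\<in>Poly_Mapping.keys f. \<Sum>t\<in>Poly_Mapping.keys g.
     Poly_Mapping.single (b s t) (Poly_Mapping.lookup f s * Poly_Mapping.lookup g t))"

lemma bilinear_ext_add_left: "bilinear_ext b (f + f') g = bilinear_ext b f g + bilinear_ext b f' g"
  unfolding bilinear_ext_def
  by (rule setsum_keys_plus_distrib) (simp_all add: distrib_right single_add sum.distrib)

lemma bilinear_ext_add_right: "bilinear_ext b f (g + g') = bilinear_ext b f g + bilinear_ext b f g'"
proof -
  have "(\<Sum>t\<in>Poly_Mapping.keys (g + g'). Poly_Mapping.single (b s t) (x * Poly_Mapping.lookup (g + g') t)) =
     (\<Sum>t\<in>Poly_Mapping.keys g. Poly_Mapping.single (b s t) (x * Poly_Mapping.lookup g t)) +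
     (\<Sum>t\<in>Poly_Mapping.keys g'. Poly_Mapping.single (b s t) (x * Poly_Mapping.lookup g' t))" for s x
    by (rule setsum_keys_plus_distrib) (simp_all add: distrib_left single_add)
  then show ?thesis by (simp add: bilinear_ext_def sum.distrib)
qed

lemma bilinear_ext_single:
  "bilinear_ext b (Poly_Mapping.single s x) (Poly_Mapping.single t y) = Poly_Mapping.single (b s t) (x * y)"
  by (simp add: bilinear_ext_def)

lemmas bilinear_ext_simps = bilinear_ext_add_left bilinear_ext_add_right bilinear_ext_single

lemma keys_bilinear_ext:
  "Poly_Mapping.keys (bilinear_ext b f g) \<subseteq> {b s t | s t. s \<in> Poly_Mapping.keys f \<and> t \<in> Poly_Mapping.keys g}"
proof
  fix k assume "k \<in> Poly_Mapping.keys (bilinear_ext b f g)"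
  then have "(\<Sum>s\<in>Poly_Mapping.keys f. \<Sum>t\<in>Poly_Mapping.keys g.
     Poly_Mapping.lookup (Poly_Mapping.single (b s t) (Poly_Mapping.lookup f s * Poly_Mapping.lookup g t)) k) \<noteq> 0"
    by (simp add: bilinear_ext_def in_keys_iff lookup_sum)
  then obtain s t where "s \<in> Poly_Mapping.keys f" "t \<in> Poly_Mapping.keys g"
    "Poly_Mapping.lookup (Poly_Mapping.single (b s t) (Poly_Mapping.lookup f s * Poly_Mapping.lookup g t)) k \<noteq> 0"
    by (metis (no_types, lifting) sum.neutral)
  then show "k \<in> {b s t | s t. s \<in> Poly_Mapping.keys f \<and> t \<in> Poly_Mapping.keys g}"
    by (auto simp: lookup_single when_def split: if_splits)
qed

lemma free_operad_simps:
  "f \<in> op_space free_operad n \<longleftrightarrow> (\<forall>t\<in>Poly_Mapping.keys f. size1 t = n)"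
  "op_add free_operad n f g = f + g"
  "op_scale free_operad n c f = Poly_Mapping.map ((*) c) f"
  "op_unit free_operad = Poly_Mapping.single \<langle>\<rangle> 1"
  "op_comp free_operad m n i f g = bilinear_ext (graft i) f g"
  by (simp_all add: free_operad_def bilinear_ext_def)

lemma lookup_scale: "Poly_Mapping.lookup (Poly_Mapping.map ((*) c) f) k = c * Poly_Mapping.lookup f k"
  for c :: rat
  by (simp add: Poly_Mapping.map.rep_eq when_def)

lemma keys_scale: "Poly_Mapping.keys (Poly_Mapping.map ((*) c) f) \<subseteq> Poly_Mapping.keys f"
  for c :: rat
  by (auto simp: in_keys_iff lookup_scale)

lemma free_space_add:
  "f \<in> op_space free_operad n \<Longrightarrow> g \<in> op_space free_operad n \<Longrightarrow> f + g \<in> op_space free_operad n"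
  using keys_add[of f g] by (auto simp: free_operad_simps)

lemma free_space_scale:
  "f \<in> op_space free_operad n \<Longrightarrow> Poly_Mapping.map ((*) c) f \<in> op_space free_operad n"
  using keys_scale[of c f] by (auto simp: free_operad_simps)

lemma free_space_comp:
  assumes "f \<in> op_space free_operad m" "g \<in> op_space free_operad n" "1 \<le> i" "i \<le> m"
  shows "bilinear_ext (graft i) f g \<in> op_space free_operad (m + n - 1)"
  using assms keys_bilinear_ext[of "graft i" f g]
  by (fastforce simp: free_operad_simps size1_graft)

lemma free_space_single: "size1 t = n \<Longrightarrow> Poly_Mapping.single t c \<in> op_space free_operad n"
  by (simp add: free_operad_simps)

lemma free_space_0: "0 \<in> op_space free_operad n"
  by (simp add: free_operad_simps)

lemma free_space_sum:
  "(\<And>i. i \<in> I \<Longrightarrow> f i \<in> op_space free_operad n) \<Longrightarrow> sum f I \<in> op_space free_operad n"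
  by (induction I rule: infinite_finite_induct) (auto intro: free_space_add free_space_0)

text \<open>
  The two products of the free operad that correspond to \<open>\<succ>\<close> (for \<open>L\<close>) and \<open>\<prec>\<close> (for \<open>R\<close>).
\<close>

abbreviation join :: "dend_gen \<Rightarrow> (dend_gen tree \<Rightarrow>\<^sub>0 rat) \<Rightarrow> (dend_gen tree \<Rightarrow>\<^sub>0 rat) \<Rightarrow> (dend_gen tree \<Rightarrow>\<^sub>0 rat)" where
  "join x \<equiv> bilinear_ext (\<lambda>s t. \<langle>s, x, t\<rangle>)"

lemma join_eq_comp:
  "join x f g = bilinear_ext (graft 1) (bilinear_ext (graft 2) (free_gen x) g) f"
proof -
  have 1: "join x (Poly_Mapping.single s a) g =
      bilinear_ext (graft 1) (bilinear_ext (graft 2) (free_gen x) g) (Poly_Mapping.single s a)" for s a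
    by (rule additive_eqI[of "\<lambda>g. join x (Poly_Mapping.single s a) g"])
      (simp_all add: bilinear_ext_simps free_gen_def mult.commute)
  show ?thesis
    by (rule additive_eqI[of "\<lambda>f. join x f g"]) (simp_all add: bilinear_ext_simps 1)
qed

section \<open>The dendriform congruence\<close>

abbreviation dend_cong :: "nat \<Rightarrow> (dend_gen tree \<Rightarrow>\<^sub>0 rat) \<Rightarrow> (dend_gen tree \<Rightarrow>\<^sub>0 rat) \<Rightarrow> bool" where
  "dend_cong \<equiv> operad_cong free_operad dend_rel"

abbreviation of_tree :: "'g tree \<Rightarrow> 'g tree \<Rightarrow>\<^sub>0 rat" where
  "of_tree t \<equiv> Poly_Mapping.single t 1"

lemma dend_rel_cases:
  assumes "dend_rel n f g"
  obtains
    "n = 3"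
      "f = of_tree \<langle>\<langle>\<langle>\<rangle>, L, \<langle>\<rangle>\<rangle>, L, \<langle>\<rangle>\<rangle> +
        of_tree \<langle>\<langle>\<langle>\<rangle>, R, \<langle>\<rangle>\<rangle>, L, \<langle>\<rangle>\<rangle>"
      "g = of_tree \<langle>\<langle>\<rangle>, L, \<langle>\<langle>\<rangle>, L, \<langle>\<rangle>\<rangle>\<rangle>"
  | "n = 3"
      "f = of_tree \<langle>\<langle>\<langle>\<rangle>, L, \<langle>\<rangle>\<rangle>, R, \<langle>\<rangle>\<rangle>"
      "g = of_tree \<langle>\<langle>\<rangle>, L, \<langle>\<langle>\<rangle>, R, \<langle>\<rangle>\<rangle>\<rangle>"
  | "n = 3"
      "f = of_tree \<langle>\<langle>\<langle>\<rangle>, R, \<langle>\<rangle>\<rangle>, R, \<langle>\<rangle>\<rangle>"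
      "g = of_tree \<langle>\<langle>\<rangle>, R, \<langle>\<langle>\<rangle>, L, \<langle>\<rangle>\<rangle>\<rangle> +
        of_tree \<langle>\<langle>\<rangle>, R, \<langle>\<langle>\<rangle>, R, \<langle>\<rangle>\<rangle>\<rangle>"
  using assms unfolding dend_rel_def
  by (auto simp: free_gen_def free_operad_simps bilinear_ext_simps Let_def)

lemma dend_relI:
  "dend_rel 3
     (of_tree \<langle>\<langle>\<langle>\<rangle>, L, \<langle>\<rangle>\<rangle>, L, \<langle>\<rangle>\<rangle> +
        of_tree \<langle>\<langle>\<langle>\<rangle>, R, \<langle>\<rangle>\<rangle>, L, \<langle>\<rangle>\<rangle>)
     (of_tree \<langle>\<langle>\<rangle>, L, \<langle>\<langle>\<rangle>, L, \<langle>\<rangle>\<rangle>\<rangle>)"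
  "dend_rel 3
     (of_tree \<langle>\<langle>\<langle>\<rangle>, L, \<langle>\<rangle>\<rangle>, R, \<langle>\<rangle>\<rangle>)
     (of_tree \<langle>\<langle>\<rangle>, L, \<langle>\<langle>\<rangle>, R, \<langle>\<rangle>\<rangle>\<rangle>)"
  "dend_rel 3
     (of_tree \<langle>\<langle>\<langle>\<rangle>, R, \<langle>\<rangle>\<rangle>, R, \<langle>\<rangle>\<rangle>)
     (of_tree \<langle>\<langle>\<rangle>, R, \<langle>\<langle>\<rangle>, L, \<langle>\<rangle>\<rangle>\<rangle> +
        of_tree \<langle>\<langle>\<rangle>, R, \<langle>\<langle>\<rangle>, R, \<langle>\<rangle>\<rangle>\<rangle>)"
  unfolding dend_rel_def
  by (auto simp: free_gen_def free_operad_simps bilinear_ext_simps Let_def)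

lemma dend_cong_space:
  assumes "dend_cong n f g"
  shows "f \<in> op_space free_operad n" "g \<in> op_space free_operad n"
proof -
  from assms have "f \<in> op_space free_operad n \<and> g \<in> op_space free_operad n"
  proof induction
    case (rel n f g)
    then show ?case
      by (rule dend_rel_cases) (auto intro!: free_space_add free_space_single)
  next
    case (comp m f f' n g g' i)
    then show ?case using free_space_comp[of _ m _ n i] by (auto simp: free_operad_simps(5))
  qed (auto simp: free_operad_simps(2,3) free_space_add free_space_scale)
  then show "f \<in> op_space free_operad n" "g \<in> op_space free_operad n" by auto
qed

lemma equiv_dend_cong: "equiv (op_space free_operad n) (operad_cong_set free_operad dend_rel n)"
  by (rule equivI)
    (auto simp: operad_cong_set_def refl_on_def sym_def trans_def
      dest: dend_cong_space intro: operad_cong.refl operad_cong.sym operad_cong.trans)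

lemma dend_cong_add: "dend_cong n f f' \<Longrightarrow> dend_cong n g g' \<Longrightarrow> dend_cong n (f + g) (f' + g')"
  using operad_cong.add[of free_operad dend_rel n f f' g g'] by (simp add: free_operad_simps)

lemma dend_cong_comp:
  "dend_cong m f f' \<Longrightarrow> dend_cong n g g' \<Longrightarrow> 1 \<le> n \<Longrightarrow> 1 \<le> i \<Longrightarrow> i \<le> m \<Longrightarrow> k = m + n - 1 \<Longrightarrow>
    dend_cong k (bilinear_ext (graft i) f g) (bilinear_ext (graft i) f' g')"
  using operad_cong.comp[of free_operad dend_rel m f f' n g g' i] by (simp add: free_operad_simps)

lemma dend_cong_of_tree: "size1 t = n \<Longrightarrow> dend_cong n (Poly_Mapping.single t c) (Poly_Mapping.single t c)"
  by (intro operad_cong.refl free_space_single)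

lemma dend_cong_join:
  assumes "dend_cong m f f'" "dend_cong n g g'" "1 \<le> m" "1 \<le> n"
  shows "dend_cong (m + n) (join x f g) (join x f' g')"
proof -
  have "dend_cong 2 (free_gen x) (free_gen x)"
    unfolding free_gen_def by (rule dend_cong_of_tree) simp
  then have "dend_cong (1 + n) (bilinear_ext (graft 2) (free_gen x) g) (bilinear_ext (graft 2) (free_gen x) g')"
    by (rule dend_cong_comp[OF _ assms(2,4)]) (use assms in auto)
  then show ?thesis
    unfolding join_eq_comp by (rule dend_cong_comp[OF _ assms(1,3)]) (use assms in auto)
qed

text \<open>
  A congruence in arity \<open>3\<close> remains valid after three arbitrary trees are plugged in.
\<close>

lemma dend_cong_plug:
  fixes a b c :: "dend_gen tree"
  assumes "dend_cong 3 f g"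
  defines "plug \<equiv> \<lambda>f. bilinear_ext (graft 1) (bilinear_ext (graft 2)
    (bilinear_ext (graft 3) f (of_tree c)) (of_tree b)) (of_tree a)"
  shows "dend_cong (size1 a + size1 b + size1 c) (plug f) (plug g)"
proof -
  have 3: "dend_cong (2 + size1 c) (bilinear_ext (graft 3) f (of_tree c)) (bilinear_ext (graft 3) g (of_tree c))"
    by (rule dend_cong_comp[OF assms(1) dend_cong_of_tree[OF HOL.refl]]) (auto simp: Suc_le_eq)
  have 2: "dend_cong (1 + size1 b + size1 c)
      (bilinear_ext (graft 2) (bilinear_ext (graft 3) f (of_tree c)) (of_tree b))
      (bilinear_ext (graft 2) (bilinear_ext (graft 3) g (of_tree c)) (of_tree b))"
    by (rule dend_cong_comp[OF 3 dend_cong_of_tree[OF HOL.refl]]) (auto simp: Suc_le_eq)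
  show ?thesis
    unfolding plug_def
    by (rule dend_cong_comp[OF 2 dend_cong_of_tree[OF HOL.refl]]) (auto simp: Suc_le_eq)
qed

text \<open>
  The axioms of a dendriform algebra: \<open>(a * b) \<succ> c = a \<succ> (b \<succ> c)\<close>, \<open>(a \<succ> b) \<prec> c = a \<succ> (b \<prec> c)\<close> and
  \<open>(a \<prec> b) \<prec> c = a \<prec> (b * c)\<close>, where \<open>a * b = a \<succ> b + a \<prec> b\<close>.
\<close>

lemma dendriform:
  "dend_cong (size1 a + size1 b + size1 c)
     (of_tree \<langle>\<langle>a, L, b\<rangle>, L, c\<rangle> + of_tree \<langle>\<langle>a, R, b\<rangle>, L, c\<rangle>) (of_tree \<langle>a, L, \<langle>b, L, c\<rangle>\<rangle>)"
  "dend_cong (size1 a + size1 b + size1 c)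
     (of_tree \<langle>\<langle>a, L, b\<rangle>, R, c\<rangle>) (of_tree \<langle>a, L, \<langle>b, R, c\<rangle>\<rangle>)"
  "dend_cong (size1 a + size1 b + size1 c)
     (of_tree \<langle>\<langle>a, R, b\<rangle>, R, c\<rangle>) (of_tree \<langle>a, R, \<langle>b, L, c\<rangle>\<rangle> + of_tree \<langle>a, R, \<langle>b, R, c\<rangle>\<rangle>)"
  using dend_relI[THEN operad_cong.rel[of dend_rel _ _ _ free_operad], THEN dend_cong_plug[where a = a and b = b and c = c]]
  by (simp_all add: bilinear_ext_simps)

text \<open>
  In the dendriform operad, \<open>f\<close> is a linear combination of trees in \<open>S\<close>.
\<close>

definition spanned_by :: "dend_gen tree set \<Rightarrow> nat \<Rightarrow> (dend_gen tree \<Rightarrow>\<^sub>0 rat) \<Rightarrow> bool" where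
  "spanned_by S n f \<longleftrightarrow> (\<exists>g. Poly_Mapping.keys g \<subseteq> S \<and> dend_cong n f g)"

lemma spanned_by_mono: "spanned_by S n f \<Longrightarrow> S \<subseteq> S' \<Longrightarrow> spanned_by S' n f"
  unfolding spanned_by_def by blast

lemma spanned_by_cong: "dend_cong n f g \<Longrightarrow> spanned_by S n g \<Longrightarrow> spanned_by S n f"
  unfolding spanned_by_def by (blast intro: operad_cong.trans)

lemma spanned_by_add: "spanned_by S n f \<Longrightarrow> spanned_by S n g \<Longrightarrow> spanned_by S n (f + g)"
  unfolding spanned_by_def by (meson dend_cong_add keys_add order_trans Un_least)

lemma spanned_by_scale: "spanned_by S n f \<Longrightarrow> spanned_by S n (Poly_Mapping.map ((*) c) f)"
  unfolding spanned_by_def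
  by (metis operad_cong.scale free_operad_simps(3) keys_scale order_trans)

lemma spanned_by_self: "f \<in> op_space free_operad n \<Longrightarrow> Poly_Mapping.keys f \<subseteq> S \<Longrightarrow> spanned_by S n f"
  unfolding spanned_by_def by (blast intro: operad_cong.refl)

lemma spanned_by_of_tree: "t \<in> S \<Longrightarrow> size1 t = n \<Longrightarrow> spanned_by S n (of_tree t)"
  by (rule spanned_by_self) (auto simp: free_space_single)

lemma spanned_by_join:
  assumes "spanned_by S m f" "spanned_by S' n g" "1 \<le> m" "1 \<le> n"
  shows "spanned_by {\<langle>s, x, t\<rangle> | s t. s \<in> S \<and> t \<in> S'} (m + n) (join x f g)"
proof -
  from assms obtain f' g' where *: "Poly_Mapping.keys f' \<subseteq> S" "dend_cong m f f'"
    "Poly_Mapping.keys g' \<subseteq> S'" "dend_cong n g g'"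
    unfolding spanned_by_def by blast
  have "Poly_Mapping.keys (join x f' g') \<subseteq> {\<langle>s, x, t\<rangle> | s t. s \<in> S \<and> t \<in> S'}"
    using keys_bilinear_ext[of "\<lambda>s t. \<langle>s, x, t\<rangle>" f' g'] * by blast
  then show ?thesis
    using dend_cong_join[OF *(2,4) assms(3,4)] unfolding spanned_by_def by blast
qed

declare right_factor.simps [simp del]

text \<open>
  The basis elements of arity \<open>n\<close>.
\<close>

definition basis_trees :: "nat \<Rightarrow> dend_gen tree set" where
  "basis_trees n = basis_tree ` {T. T \<noteq> \<langle>\<rangle> \<and> size T = n}"

text \<open>
  The span of the basis elements is closed under \<open>\<succ>\<close> and \<open>\<prec>\<close>, by induction on the total size:
  \<open>A \<succ> (B\<^sub>1 \<or> B\<^sub>2) = (A * B\<^sub>1) \<or> B\<^sub>2\<close> and \<open>(A\<^sub>1 \<or> A\<^sub>2) \<prec> B = A\<^sub>1 \<or> (A\<^sub>2 * B)\<close>, where the products \<open>A * B\<^sub>1\<close> and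
  \<open>A\<^sub>2 * B\<close> are in the span by the induction hypothesis; an empty
  tree acts as a unit for \<open>*\<close>.
\<close>

lemma spanned_by_join_basis_trees:
  assumes "A \<noteq> \<langle>\<rangle>" "B \<noteq> \<langle>\<rangle>"
  shows "spanned_by (basis_trees (size A + size B)) (size A + size B) (of_tree \<langle>basis_tree A, x, basis_tree B\<rangle>)"
  using assms
proof (induction "size A + size B" arbitrary: A B x rule: less_induct)
  case less
  have IH: "spanned_by (basis_trees (size C + size D)) (size C + size D) (of_tree \<langle>basis_tree C, x, basis_tree D\<rangle>)"
    if "C \<noteq> \<langle>\<rangle>" "D \<noteq> \<langle>\<rangle>" "size C + size D < size A + size B" for C D x
    using less.hyps that by blast
  have join_single: "join x (of_tree s) (of_tree t) = of_tree \<langle>s, x, t\<rangle>" for s t and x :: dend_gen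
    by (simp add: bilinear_ext_single)
  have pos: "1 \<le> size T" if "T \<noteq> \<langle>\<rangle>" for T :: "unit tree" using that by (cases T) auto
  show ?case
  proof (cases x)
    case L
    obtain B1 B2 where B: "B = \<langle>B1, (), B2\<rangle>" using less.prems(2) by (cases B) auto
    let ?a = "basis_tree A" and ?z = "right_factor B2"
    show ?thesis
    proof (cases "B1 = \<langle>\<rangle>")
      case True
      then have "\<langle>?a, L, basis_tree B\<rangle> = basis_tree \<langle>A, (), B2\<rangle>" using less.prems B by simp
      then show ?thesis using True B L less.prems
        by (auto intro!: spanned_by_of_tree imageI simp: basis_trees_def size1_basis_tree simp del: basis_tree.simps)
    next
      case False
      let ?b = "basis_tree B1"
      have size: "size1 ?a + size1 ?b + size1 ?z = size A + size B"
        using False less.prems B by (simp add: size1_basis_tree)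
      have part: "spanned_by (basis_trees (size A + size B)) (size A + size B) (of_tree \<langle>\<langle>?a, y, ?b\<rangle>, L, ?z\<rangle>)" for y
      proof -
        have 1: "spanned_by (basis_trees (size A + size B1)) (size A + size B1) (of_tree \<langle>?a, y, ?b\<rangle>)"
          by (rule IH) (use less.prems False B in auto)
        have 2: "spanned_by {?z} (Suc (size B2)) (of_tree ?z)"
          by (rule spanned_by_of_tree) (auto simp: size1_basis_tree)
        have "spanned_by {\<langle>s, L, t\<rangle> | s t. s \<in> basis_trees (size A + size B1) \<and> t \<in> {?z}}
            (size A + size B1 + Suc (size B2)) (of_tree \<langle>\<langle>?a, y, ?b\<rangle>, L, ?z\<rangle>)"
          using spanned_by_join[OF 1 2, of L] pos[OF False] by (simp add: join_single)
        moreover have "{\<langle>s, L, t\<rangle> | s t. s \<in> basis_trees (size A + size B1) \<and> t \<in> {?z}} \<subseteq>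
            basis_trees (size A + size B)"
        proof clarify
          fix s assume "s \<in> basis_trees (size A + size B1)"
          then obtain C where "C \<noteq> \<langle>\<rangle>" "size C = size A + size B1" "s = basis_tree C"
            unfolding basis_trees_def by blast
          then show "\<langle>s, L, ?z\<rangle> \<in> basis_trees (size A + size B)"
            unfolding basis_trees_def using B
            by (intro image_eqI[of _ _ "\<langle>C, (), B2\<rangle>"]) auto
        qed
        ultimately show ?thesis
          using B spanned_by_mono by (simp add: add.assoc)
      qed
      have "basis_tree B = \<langle>?b, L, ?z\<rangle>" using False B by simp
      moreover have "dend_cong (size A + size B) (of_tree \<langle>?a, L, \<langle>?b, L, ?z\<rangle>\<rangle>)
          (of_tree \<langle>\<langle>?a, L, ?b\<rangle>, L, ?z\<rangle> + of_tree \<langle>\<langle>?a, R, ?b\<rangle>, L, ?z\<rangle>)"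
        using operad_cong.sym[OF dendriform(1)[of ?a ?b ?z]] size by simp
      ultimately show ?thesis
        using spanned_by_cong[OF _ spanned_by_add[OF part part]] L by simp
    qed
  next
    case R
    obtain A1 A2 where A: "A = \<langle>A1, (), A2\<rangle>" using less.prems(1) by (cases A) auto
    let ?b = "basis_tree B" and ?z = "right_factor A2"
    let ?n = "size A2 + size B"
    \<comment> \<open>\<open>(Y \<prec> A\<^sub>2) \<prec> B = Y \<prec> (A\<^sub>2 * B)\<close>\<close>
    have right: "spanned_by {right_factor C | C. size C = ?n} (Suc ?n) (of_tree \<langle>?z, R, ?b\<rangle>)"
    proof (cases "A2 = \<langle>\<rangle>")
      case True
      then have "\<langle>?z, R, ?b\<rangle> = right_factor B" using less.prems by (simp add: right_factor.simps)
      then show ?thesis using True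
        by (auto intro!: spanned_by_of_tree simp: size1_basis_tree)
    next
      case False
      let ?a = "basis_tree A2"
      have part: "spanned_by {right_factor C | C. size C = ?n} (Suc ?n) (of_tree \<langle>\<langle>\<rangle>, R, \<langle>?a, y, ?b\<rangle>\<rangle>)" for y
      proof -
        have 1: "spanned_by (basis_trees ?n) ?n (of_tree \<langle>?a, y, ?b\<rangle>)"
          by (rule IH) (use less.prems False A in auto)
        have 2: "spanned_by {\<langle>\<rangle>} 1 (of_tree \<langle>\<rangle>)"
          by (rule spanned_by_of_tree) auto
        have "spanned_by {\<langle>s, R, t\<rangle> | s t. s \<in> {\<langle>\<rangle>} \<and> t \<in> basis_trees ?n}
            (Suc ?n) (of_tree \<langle>\<langle>\<rangle>, R, \<langle>?a, y, ?b\<rangle>\<rangle>)"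
          using spanned_by_join[OF 2 1, of R] pos[OF False] by (simp add: join_single)
        moreover have "{\<langle>s, R, t\<rangle> | s t. s \<in> {\<langle>\<rangle>} \<and> t \<in> basis_trees ?n} \<subseteq> {right_factor C | C. size C = ?n}"
        proof clarify
          fix t assume "t \<in> basis_trees ?n"
          then obtain C where "C \<noteq> \<langle>\<rangle>" "size C = ?n" "t = basis_tree C"
            unfolding basis_trees_def by blast
          then show "\<exists>C. \<langle>\<langle>\<rangle>, R, t\<rangle> = right_factor C \<and> size C = ?n"
            by (intro exI[of _ C]) (simp add: right_factor.simps)
        qed
        ultimately show ?thesis
          by (rule spanned_by_mono)
      qed
      have "?z = \<langle>\<langle>\<rangle>, R, ?a\<rangle>" using False by (simp add: right_factor.simps)
      moreover have "dend_cong (Suc ?n) (of_tree \<langle>\<langle>\<langle>\<rangle>, R, ?a\<rangle>, R, ?b\<rangle>)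
          (of_tree \<langle>\<langle>\<rangle>, R, \<langle>?a, L, ?b\<rangle>\<rangle> + of_tree \<langle>\<langle>\<rangle>, R, \<langle>?a, R, ?b\<rangle>\<rangle>)"
        using dendriform(3)[of "\<langle>\<rangle>" ?a ?b] False less.prems by (simp add: size1_basis_tree)
      ultimately show ?thesis
        using spanned_by_cong[OF _ spanned_by_add[OF part part]] by simp
    qed
    show ?thesis
    proof (cases "A1 = \<langle>\<rangle>")
      case True
      then have "{right_factor C | C. size C = ?n} \<subseteq> basis_trees (size A + size B)"
        using A by (auto simp: basis_trees_def intro!: image_eqI[of _ _ "\<langle>\<langle>\<rangle>, (), _\<rangle>"])
      from spanned_by_mono[OF right this] show ?thesis using True R A by simp
    next
      case False
      let ?a = "basis_tree A1"
      have 1: "spanned_by {?a} (size A1) (of_tree ?a)"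
        by (rule spanned_by_of_tree) (auto simp: size1_basis_tree False)
      have span: "spanned_by {\<langle>s, L, t\<rangle> | s t. s \<in> {?a} \<and> t \<in> {right_factor C | C. size C = ?n}}
          (size A1 + Suc ?n) (of_tree \<langle>?a, L, \<langle>?z, R, ?b\<rangle>\<rangle>)"
        using spanned_by_join[OF 1 right, of L] pos[OF False] by (simp add: join_single)
      have subset: "{\<langle>s, L, t\<rangle> | s t. s \<in> {?a} \<and> t \<in> {right_factor C | C. size C = ?n}} \<subseteq>
          basis_trees (size A + size B)"
      proof clarify
        fix C :: "unit tree" assume "size C = ?n"
        then show "\<langle>?a, L, right_factor C\<rangle> \<in> basis_trees (size A + size B)"
          unfolding basis_trees_def using A False
          by (intro image_eqI[of _ _ "\<langle>A1, (), C\<rangle>"]) auto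
      qed
      have size: "size A1 + Suc ?n = size A + size B" using A by simp
      have "spanned_by (basis_trees (size A + size B)) (size A + size B)
          (of_tree \<langle>?a, L, \<langle>?z, R, ?b\<rangle>\<rangle>)"
        using spanned_by_mono[OF span subset] unfolding size .
      moreover have "size1 ?a + size1 ?z + size1 ?b = size A + size B"
        using False less.prems A by (simp add: size1_basis_tree)
      moreover have "basis_tree A = \<langle>?a, L, ?z\<rangle>" using False A by simp
      ultimately show ?thesis
        using spanned_by_cong[OF dendriform(2)[of ?a ?z ?b]] R by simp
    qed
  qed
qed

lemma spanned_by_0: "spanned_by S n 0"
  by (rule spanned_by_self) (auto simp: free_space_0)

lemma spanned_by_sum: "(\<And>i. i \<in> I \<Longrightarrow> spanned_by S n (f i)) \<Longrightarrow> spanned_by S n (sum f I)"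
  by (induction I rule: infinite_finite_induct) (auto simp: spanned_by_0 intro: spanned_by_add)

lemma spanned_by_singles:
  assumes "\<And>t. t \<in> Poly_Mapping.keys f \<Longrightarrow> spanned_by S n (of_tree t)"
  shows "spanned_by S n f"
proof -
  have "spanned_by S n (Poly_Mapping.single t c)" if "t \<in> Poly_Mapping.keys f" for t c
    using spanned_by_scale[OF assms[OF that], of c] by simp
  then have "spanned_by S n (\<Sum>t\<in>Poly_Mapping.keys f. Poly_Mapping.single t (Poly_Mapping.lookup f t))"
    by (intro spanned_by_sum)
  then show ?thesis by (simp add: sum_of_singles)
qed

lemma spanned_by_of_tree_basis_trees: "spanned_by (basis_trees (size1 t)) (size1 t) (of_tree t)"
proof (induction t)
  case Leaf
  show ?case
    by (rule spanned_by_of_tree) (auto simp: basis_trees_def right_factor.simps intro!: image_eqI[of _ _ "\<langle>\<langle>\<rangle>, (), \<langle>\<rangle>\<rangle>"])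
next
  case (Node l x r)
  let ?n = "size1 l + size1 r"
  have "spanned_by {\<langle>s, x, t\<rangle> | s t. s \<in> basis_trees (size1 l) \<and> t \<in> basis_trees (size1 r)} ?n (of_tree \<langle>l, x, r\<rangle>)"
    using spanned_by_join[OF Node.IH, of x] by (simp add: bilinear_ext_single Suc_le_eq)
  then obtain g where g: "Poly_Mapping.keys g \<subseteq> {\<langle>s, x, t\<rangle> | s t. s \<in> basis_trees (size1 l) \<and> t \<in> basis_trees (size1 r)}"
    "dend_cong ?n (of_tree \<langle>l, x, r\<rangle>) g"
    unfolding spanned_by_def by blast
  have "spanned_by (basis_trees ?n) ?n (of_tree t)" if "t \<in> Poly_Mapping.keys g" for t
  proof -
    have "t \<in> {\<langle>s, x, t\<rangle> | s t. s \<in> basis_trees (size1 l) \<and> t \<in> basis_trees (size1 r)}"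
      using g(1) that by blast
    then obtain A B where "A \<noteq> \<langle>\<rangle>" "B \<noteq> \<langle>\<rangle>" "size A = size1 l" "size B = size1 r"
      "t = \<langle>basis_tree A, x, basis_tree B\<rangle>"
      unfolding basis_trees_def by blast
    then show ?thesis using spanned_by_join_basis_trees[of A B x] by simp
  qed
  from spanned_by_cong[OF g(2) spanned_by_singles[OF this]] show ?case by simp
qed

lemma spanned_by_basis_trees: "f \<in> op_space free_operad n \<Longrightarrow> spanned_by (basis_trees n) n f"
  by (rule spanned_by_singles) (metis free_operad_simps(1) spanned_by_of_tree_basis_trees)

section \<open>The value of an element of the free operad\<close>

text \<open>
  The linear extension of \<^const>\<open>tree_value\<close>, the coefficients being mapped by \<open>h\<close>.
\<close>

definition free_value :: "(rat \<Rightarrow> 'a::field) \<Rightarrow> 'a list \<Rightarrow> (dend_gen tree \<Rightarrow>\<^sub>0 rat) \<Rightarrow> 'a" where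
  "free_value h xs f = (\<Sum>t\<in>Poly_Mapping.keys f. h (Poly_Mapping.lookup f t) * tree_value t xs)"

context
  fixes h :: "rat \<Rightarrow> 'a::field"
  assumes h: "ring_morphism h"
begin

interpretation ring_morphism h by (fact h)

lemma free_value_add: "free_value h xs (f + g) = free_value h xs f + free_value h xs g"
  unfolding free_value_def
  by (rule setsum_keys_plus_distrib) (simp_all add: zero add algebra_simps)

lemma free_value_single: "free_value h xs (Poly_Mapping.single t c) = h c * tree_value t xs"
  by (simp add: free_value_def zero)

lemma free_value_0: "free_value h xs 0 = 0"
  by (simp add: free_value_def)

lemma free_value_sum: "free_value h xs (sum f I) = (\<Sum>i\<in>I. free_value h xs (f i))"
  by (induction I rule: infinite_finite_induct) (simp_all add: free_value_add free_value_0)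

lemma free_value_diff: "free_value h xs (f - g) = free_value h xs f - free_value h xs g"
  using free_value_add[of xs "f - g" g] by simp

lemma free_value_scale: "free_value h xs (Poly_Mapping.map ((*) c) f) = h c * free_value h xs f"
proof -
  have "free_value h xs (Poly_Mapping.map ((*) c) f) =
      (\<Sum>t\<in>Poly_Mapping.keys f. h (c * Poly_Mapping.lookup f t) * tree_value t xs)"
    unfolding free_value_def
    by (rule sum.mono_neutral_cong_left) (use keys_scale[of c f] in \<open>auto simp: lookup_scale in_keys_iff zero\<close>)
  then show ?thesis by (simp add: free_value_def mult sum_distrib_left mult_ac)
qed

lemma free_value_comp:
  assumes f: "f \<in> op_space free_operad (length xs + 1 + length zs)"
    and g: "g \<in> op_space free_operad (length ys)" and "sum_list ys \<noteq> 0"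
  shows "free_value h (xs @ ys @ zs) (bilinear_ext (graft (length xs + 1)) f g) =
    sum_list ys * free_value h (xs @ [sum_list ys] @ zs) f * free_value h ys g"
proof -
  let ?i = "length xs + 1"
  have "free_value h (xs @ ys @ zs) (bilinear_ext (graft ?i) f g) =
      (\<Sum>s\<in>Poly_Mapping.keys f. \<Sum>t\<in>Poly_Mapping.keys g.
        h (Poly_Mapping.lookup f s * Poly_Mapping.lookup g t) * tree_value (graft ?i s t) (xs @ ys @ zs))"
    by (simp add: bilinear_ext_def free_value_sum free_value_single)
  also have "\<dots> = (\<Sum>s\<in>Poly_Mapping.keys f. \<Sum>t\<in>Poly_Mapping.keys g. sum_list ys *
        ((h (Poly_Mapping.lookup f s) * tree_value s (xs @ [sum_list ys] @ zs)) *
         (h (Poly_Mapping.lookup g t) * tree_value t ys)))"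
    using assms
    by (intro sum.cong HOL.refl, subst tree_value_graft) (simp_all add: free_operad_simps(1) mult mult_ac)
  also have "\<dots> = sum_list ys * free_value h (xs @ [sum_list ys] @ zs) f * free_value h ys g"
    by (simp add: free_value_def sum_product sum_distrib_left mult_ac)
  finally show ?thesis .
qed

lemma specializes_free_value:
  assumes "list_all2 (specializes (peval h \<sigma>)) fs xs" "zero_sum_free xs"
    and "f \<in> op_space free_operad (length xs)"
  shows "specializes (peval h \<sigma>) (free_value rconst fs f) (free_value h xs f)"
proof -
  note e = ring_morphism_peval[OF h, of \<sigma>]
  show ?thesis
    unfolding free_value_def using assms
    by (intro specializes_sum[OF e] specializes_mult[OF e] specializes_rconst[OF h] specializes_tree_value[OF e])
      (auto simp: free_operad_simps(1))
qed

lemma free_value_dend_rel: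
  assumes "dend_rel n f g" and zsf: "zero_sum_free [a, b, c]"
  shows "free_value h [a, b, c] f = free_value h [a, b, c] g"
proof -
  have nz: "sum_list zs \<noteq> 0" if "zs \<noteq> []" "set zs \<subseteq> {a, b, c}" for zs
    using zsf that by (simp add: zero_sum_free_def)
  have *: "a \<noteq> 0" "b \<noteq> 0" "c \<noteq> 0" "a + b \<noteq> 0" "b + c \<noteq> 0" "a + (b + c) \<noteq> 0"
    using nz[of "[a]"] nz[of "[b]"] nz[of "[c]"] nz[of "[a, b]"] nz[of "[b, c]"] nz[of "[a, b, c]"]
    by simp_all
  have ab: "b / (a + b) * x + a / (a + b) * x = x" and bc: "c / (b + c) * x + b / (b + c) * x = x" for x
    using * by (simp_all add: add_divide_distrib[symmetric] distrib_right[symmetric] add.commute)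
  from assms(1) show ?thesis
  proof (cases rule: dend_rel_cases)
    case 1
    then show ?thesis using * ab[of "1 / a / b / (a + (b + c))"]
      by (simp add: free_value_add free_value_single one mult_ac)
  next
    case 2
    then show ?thesis using * by (simp add: free_value_single one)
  next
    case 3
    then show ?thesis using * bc[of "1 / b / c / (a + (b + c))"]
      by (simp add: free_value_add free_value_single one mult_ac)
  qed
qed

end

section \<open>The morphism to the operad of rational functions\<close>

text \<open>The variables \<open>u\<^sub>1, \<dots>, u\<^sub>n\<close>.\<close>

definition vars :: "nat \<Rightarrow> ratfun list" where
  "vars n = map u [1..<n + 1]"

text \<open>
  Rational functions with positive values at the point \<open>(1, 1, \<dots>)\<close> have nonzero sums.  This applies
  to the variables and to sums of variables, which are all that is ever substituted.
\<close>

lemma zero_sum_free_ratfun: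
  assumes "\<And>x. x \<in> set xs \<Longrightarrow> \<exists>r>0. specializes (peval of_rat (\<lambda>_. 1 :: real)) x r"
  shows "zero_sum_free xs"
  unfolding zero_sum_free_def
proof (intro allI impI notI, elim conjE)
  let ?e = "peval of_rat (\<lambda>_. 1 :: real)"
  note e = ring_morphism_peval[OF ring_morphism_of_rat, of "\<lambda>_. 1"]
  fix zs :: "ratfun list" assume zs: "zs \<noteq> []" "set zs \<subseteq> set xs" "sum_list zs = 0"
  have "\<forall>x\<in>set zs. \<exists>r>0. specializes ?e x r"
    using assms zs(2) by blast
  from bchoice[OF this] obtain r where r: "\<forall>x\<in>set zs. r x > 0 \<and> specializes ?e x (r x)"
    by blast
  then have "list_all2 (specializes ?e) zs (map r zs)"
    by (simp add: list_all2_conv_all_nth)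
  from specializes_sum_list[OF e this] zs(3) have "sum_list (map r zs) = 0"
    using specializes_unique[OF e _ specializes_0[OF e]] by simp
  moreover have "sum_list (map r zs) > 0" using r zs(1) by (intro sum_list_positive) auto
  ultimately show False by simp
qed

lemma specializes_u_1: "specializes (peval of_rat (\<lambda>_. 1 :: real)) (u k) 1"
  using specializes_u[OF ring_morphism_of_rat, of "\<lambda>_. 1"] .

lemma zero_sum_free_u: "zero_sum_free (map u ks)"
  by (rule zero_sum_free_ratfun) (use specializes_u_1 in \<open>auto intro!: exI[of _ 1]\<close>)

lemma rsubst_free_value:
  assumes "f \<in> op_space free_operad m" "zero_sum_free (map \<sigma> [1..<m + 1])"
  shows "rsubst \<sigma> (free_value rconst (vars m) f) = free_value rconst (map \<sigma> [1..<m + 1]) f"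
  using assms
  by (intro rsubst_eqI, unfold poly_eval_eq_peval, intro specializes_free_value[OF ring_morphism_rconst])
    (simp_all add: vars_def list_all2_conv_all_nth specializes_u[OF ring_morphism_rconst] del: upt_Suc)

lemma mould_comp_free_value:
  assumes f: "f \<in> op_space free_operad m" and g: "g \<in> op_space free_operad n"
    and "1 \<le> n" "1 \<le> i" "i \<le> m"
  shows "op_comp Mould m n i (free_value rconst (vars m) f) (free_value rconst (vars n) g) =
    free_value rconst (vars (m + n - 1)) (op_comp free_operad m n i f g)"
proof -
  define w where "w = (\<Sum>k = i..i + n - 1. u k)"
  define xs where "xs = map u [1..<i]"
  define ys where "ys = map u [i..<i + n]"
  define zs where "zs = map u [i + n..<m + n]"
  let ?\<sigma> = "\<lambda>k. if k < i then u k else if k = i then w else u (k + n - 1)"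
  have "{i..i + n - 1} = {i..<i + n}" using assms by auto
  then have w: "w = sum_list ys"
    unfolding w_def ys_def by (simp add: interv_sum_list_conv_sum_set_nat)
  have zsf_ys: "zero_sum_free ys" unfolding ys_def by (rule zero_sum_free_u)
  have ys: "map (\<lambda>k. u (i + k - 1)) [1..<n + 1] = ys"
    unfolding ys_def by (rule nth_equalityI) (auto simp del: upt_Suc)
  have split: "[1..<m + 1] = [1..<i] @ [i] @ [Suc i..<m + 1]"
    using assms upt_add_eq_append[of 1 i "m + 1 - i"] upt_conv_Cons[of i "m + 1"] by simp
  have "map (\<lambda>k. u (k + n - 1)) [Suc i..<m + 1] = zs"
    unfolding zs_def using assms by (intro nth_equalityI) (auto simp del: upt_Suc simp: ac_simps)
  moreover have "map ?\<sigma> [Suc i..<m + 1] = map (\<lambda>k. u (k + n - 1)) [Suc i..<m + 1]"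
    by (rule map_cong) auto
  moreover have "map ?\<sigma> [1..<i] = xs" unfolding xs_def by (rule map_cong) auto
  ultimately have xwz: "map ?\<sigma> [1..<m + 1] = xs @ [sum_list ys] @ zs"
    unfolding split w by simp
  have "zero_sum_free (xs @ [sum_list ys] @ zs)"
  proof (rule zero_sum_free_ratfun)
    fix x assume "x \<in> set (xs @ [sum_list ys] @ zs)"
    then consider "x = sum_list ys" | k where "x = u k" by (auto simp: xs_def zs_def)
    then show "\<exists>r>0. specializes (peval of_rat (\<lambda>_. 1 :: real)) x r"
    proof cases
      case 1
      have "specializes (peval of_rat (\<lambda>_. 1 :: real)) (sum_list ys) (sum_list (replicate n 1))"
        unfolding ys_def
        by (intro specializes_sum_list ring_morphism_peval ring_morphism_of_rat)
          (simp add: list_all2_conv_all_nth specializes_u_1 del: sum_list_replicate)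
      then show ?thesis using 1 assms by (intro exI[of _ "real n"]) (simp add: sum_list_replicate)
    qed (use specializes_u_1 in \<open>auto intro!: exI[of _ 1]\<close>)
  qed
  then have 1: "rsubst ?\<sigma> (free_value rconst (vars m) f) = free_value rconst (xs @ [sum_list ys] @ zs) f"
    using rsubst_free_value[OF f, of ?\<sigma>] unfolding xwz by blast
  have 2: "rsubst (\<lambda>k. u (i + k - 1)) (free_value rconst (vars n) g) = free_value rconst ys g"
    using rsubst_free_value[OF g, of "\<lambda>k. u (i + k - 1)"] zsf_ys unfolding ys by blast
  have upt_split: "[a..<c] = [a..<b] @ [b..<c]" if "a \<le> b" "b \<le> c" for a b c :: nat
    using upt_add_eq_append[of a b "c - b"] that by simp
  have vars: "vars (m + n - 1) = xs @ ys @ zs"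
    using assms upt_split[of 1 i "m + n"] upt_split[of i "i + n" "m + n"]
    by (simp add: vars_def xs_def ys_def zs_def flip: map_append del: upt_Suc)
  have "op_comp Mould m n i (free_value rconst (vars m) f) (free_value rconst (vars n) g) =
      sum_list ys * free_value rconst (xs @ [sum_list ys] @ zs) f * free_value rconst ys g"
    unfolding Mould_def by (simp only: ns_operad.simps Let_def w_def[symmetric] 1 2) (simp only: w)
  also have "\<dots> = free_value rconst (xs @ ys @ zs) (bilinear_ext (graft (length xs + 1)) f g)"
  proof (rule free_value_comp[OF ring_morphism_rconst, symmetric])
    show "f \<in> op_space free_operad (length xs + 1 + length zs)" "g \<in> op_space free_operad (length ys)"
      using f g assms by (simp_all add: xs_def ys_def zs_def)
    show "sum_list ys \<noteq> 0"
      using assms zsf_ys by (intro zero_sum_free_sum) (auto simp: ys_def)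
  qed
  also have "length xs + 1 = i" using assms by (simp add: xs_def)
  finally show ?thesis by (simp only: vars free_operad_simps)
qed

lemma dend_cong_free_value:
  assumes "dend_cong n f g" "1 \<le> n"
  shows "free_value rconst (vars n) f = free_value rconst (vars n) g"
  using assms
proof induction
  case (rel n f g)
  then have "n = 3" by (auto elim: dend_rel_cases)
  moreover have "vars 3 = [u 1, u 2, u 3]" by (simp add: vars_def upt_rec numeral_eq_Suc)
  ultimately show ?case
    using free_value_dend_rel[OF ring_morphism_rconst rel(1), of "u 1" "u 2" "u 3"]
      zero_sum_free_u[of "[1, 2, 3]"] by simp
next
  case (add n f f' g g')
  then show ?case by (simp add: free_operad_simps free_value_add[OF ring_morphism_rconst])
next
  case (scale n f f' c)
  then show ?case by (simp add: free_operad_simps free_value_scale[OF ring_morphism_rconst])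
next
  case (comp m f f' n g g' i)
  then have "1 \<le> m" by simp
  note space = dend_cong_space[OF comp(1)] dend_cong_space[OF comp(2)]
  show ?case
    unfolding mould_comp_free_value[OF space(1,3) comp(3-5), symmetric]
      mould_comp_free_value[OF space(2,4) comp(3-5), symmetric]
    by (simp only: comp.IH(1)[OF \<open>1 \<le> m\<close>] comp.IH(2)[OF comp(3)])
qed auto

text \<open>
  The rational functions in \<open>u\<^sub>1, \<dots>, u\<^sub>n\<close> form a subfield.
\<close>

lemma rational_functions_field:
  "rconst c \<in> op_space Mould n"
  "k \<in> {1..n} \<Longrightarrow> u k \<in> op_space Mould n"
  "f \<in> op_space Mould n \<Longrightarrow> g \<in> op_space Mould n \<Longrightarrow> f + g \<in> op_space Mould n"
  "f \<in> op_space Mould n \<Longrightarrow> g \<in> op_space Mould n \<Longrightarrow> f * g \<in> op_space Mould n"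
  "f \<in> op_space Mould n \<Longrightarrow> g \<in> op_space Mould n \<Longrightarrow> f / g \<in> op_space Mould n"
proof -
  define V where "V = {p. poly_vars p \<subseteq> {1..n}}"
  have M: "f \<in> op_space Mould n \<longleftrightarrow> (\<exists>p q. q \<noteq> 0 \<and> f = Fract p q \<and> p \<in> V \<and> q \<in> V)" for f
    by (simp add: Mould_def V_def)
  have V_add: "p + q \<in> V" if "p \<in> V" "q \<in> V" for p q
    using that keys_add[of p q] by (fastforce simp: V_def poly_vars_def)
  have V_mult: "p * q \<in> V" if "p \<in> V" "q \<in> V" for p q
  proof -
    have "k \<in> {1..n}" if m: "m \<in> Poly_Mapping.keys (p * q)" and k: "k \<in> Poly_Mapping.keys m" for m k
    proof -
      obtain a b where "m = a + b" "a \<in> Poly_Mapping.keys p" "b \<in> Poly_Mapping.keys q"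
        using keys_mult[of p q] m by blast
      then show ?thesis
        using k keys_add[of a b] \<open>p \<in> V\<close> \<open>q \<in> V\<close> unfolding V_def poly_vars_def by blast
    qed
    then show ?thesis by (auto simp: V_def poly_vars_def)
  qed
  have V_0: "0 \<in> V" and V_1: "1 \<in> V" by (simp_all add: V_def poly_vars_def)
  show "rconst c \<in> op_space Mould n"
    unfolding M rconst_def using V_1
    by (intro exI[of _ "Poly_Mapping.single 0 c"] exI[of _ 1]) (simp add: V_def poly_vars_def)
  show "u k \<in> op_space Mould n" if "k \<in> {1..n}"
    unfolding M u_def using V_1 that
    by (intro exI[of _ "Poly_Mapping.single (Poly_Mapping.single k 1) 1"] exI[of _ 1])
      (simp add: V_def poly_vars_def)
  assume "f \<in> op_space Mould n" "g \<in> op_space Mould n"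
  then obtain p q p' q' where *: "q \<noteq> 0" "f = Fract p q" "p \<in> V" "q \<in> V"
    "q' \<noteq> 0" "g = Fract p' q'" "p' \<in> V" "q' \<in> V"
    unfolding M by blast
  show "f + g \<in> op_space Mould n"
    unfolding M using * V_add V_mult
    by (intro exI[of _ "p * q' + p' * q"] exI[of _ "q * q'"]) simp
  show "f * g \<in> op_space Mould n"
    unfolding M using * V_mult
    by (intro exI[of _ "p * p'"] exI[of _ "q * q'"]) simp
  show "f / g \<in> op_space Mould n"
  proof (cases "p' = 0")
    case True
    then have "f / g = 0" using * by (simp add: fract_collapse)
    then show ?thesis unfolding M using V_0 V_1
      by (intro exI[of _ 0] exI[of _ 1]) (simp add: fract_collapse)
  next
    case False
    then show ?thesis unfolding M using * V_mult
      by (intro exI[of _ "p * q'"] exI[of _ "q * p'"]) simp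
  qed
qed

lemma rational_functions_0: "0 \<in> op_space Mould n"
  using rational_functions_field(1)[of 0 n] ring_morphism.zero[OF ring_morphism_rconst] by simp

lemma rational_functions_sum_list:
  "set xs \<subseteq> op_space Mould n \<Longrightarrow> sum_list xs \<in> op_space Mould n"
  by (induction xs) (auto intro: rational_functions_0 rational_functions_field(3))

lemma rational_functions_tree_value:
  "set xs \<subseteq> op_space Mould n \<Longrightarrow> tree_value t xs \<in> op_space Mould n"
proof (induction t arbitrary: xs)
  case Leaf
  have "1 \<in> op_space Mould n"
    using rational_functions_field(1)[of 1 n] ring_morphism.one[OF ring_morphism_rconst] by simp
  with Leaf show ?case
    by (auto intro: rational_functions_field(5) rational_functions_sum_list)
next
  case (Node l x r)
  have "set (take (size1 l) xs) \<subseteq> op_space Mould n" "set (drop (size1 l) xs) \<subseteq> op_space Mould n"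
    using Node.prems set_take_subset set_drop_subset by fast+
  with Node show ?case
    by (auto intro!: rational_functions_field(4,5) rational_functions_sum_list split: dend_gen.split)
qed

lemma free_value_in_Mould: "free_value rconst (vars n) f \<in> op_space Mould n"
proof -
  have sum: "(\<Sum>t\<in>S. F t) \<in> op_space Mould n" if "\<And>t. F t \<in> op_space Mould n" for S and F :: "dend_gen tree \<Rightarrow> ratfun"
    using that by (induction S rule: infinite_finite_induct)
      (auto intro: rational_functions_0 rational_functions_field(3))
  show ?thesis unfolding free_value_def
    by (intro sum rational_functions_field(4) rational_functions_field(1) rational_functions_tree_value)
      (auto simp: vars_def intro!: rational_functions_field(2) simp del: upt_Suc)
qed

text \<open>The class in \<open>Dend(n)\<close> of an element of the free operad.\<close>

abbreviation dend_cls :: "nat \<Rightarrow> (dend_gen tree \<Rightarrow>\<^sub>0 rat) \<Rightarrow> (dend_gen tree \<Rightarrow>\<^sub>0 rat) set" where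
  "dend_cls n f \<equiv> operad_cong_set free_operad dend_rel n `` {f}"

lemma dend_cls_eq: "dend_cong n f g \<Longrightarrow> dend_cls n f = dend_cls n g"
  using equiv_class_eq[OF equiv_dend_cong] by (simp add: operad_cong_set_def)

lemma Dend_space: "X \<in> op_space Dend n \<longleftrightarrow> (\<exists>f\<in>op_space free_operad n. X = dend_cls n f)"
  by (auto simp: Dend_def quotient_operad_def quotient_def)

lemma Dend_ops:
  "f \<in> op_space free_operad n \<Longrightarrow> g \<in> op_space free_operad n \<Longrightarrow>
     op_add Dend n (dend_cls n f) (dend_cls n g) = dend_cls n (f + g)"
  "f \<in> op_space free_operad n \<Longrightarrow>
     op_scale Dend n c (dend_cls n f) = dend_cls n (Poly_Mapping.map ((*) c) f)"
  "op_unit Dend = dend_cls 1 (of_tree \<langle>\<rangle>)"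
  "f \<in> op_space free_operad m \<Longrightarrow> g' \<in> op_space free_operad n \<Longrightarrow> 1 \<le> n \<Longrightarrow> 1 \<le> i \<Longrightarrow> i \<le> m \<Longrightarrow>
     op_comp Dend m n i (dend_cls m f) (dend_cls n g') =
     dend_cls (m + n - 1) (op_comp free_operad m n i f g')"
proof -
  have UN: "(\<Union>x\<in>X. H x) = C" if "x0 \<in> X" "\<And>x. x \<in> X \<Longrightarrow> H x = C" for X H x0 and C :: "'c set"
    using that by blast
  show "op_add Dend n (dend_cls n f) (dend_cls n g) = dend_cls n (f + g)"
    if "f \<in> op_space free_operad n" "g \<in> op_space free_operad n"
  proof -
    have "dend_cls n (x + y) = dend_cls n (f + g)" if "x \<in> dend_cls n f" "y \<in> dend_cls n g" for x y
      using that dend_cls_eq[OF dend_cong_add, of n f x g y] by (simp add: operad_cong_set_def)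
    moreover have "f \<in> dend_cls n f" "g \<in> dend_cls n g"
      using that by (auto simp: operad_cong_set_def intro: operad_cong.refl)
    ultimately show ?thesis
      unfolding Dend_def quotient_operad_def free_operad_simps ns_operad.simps
      by (intro UN)
  qed
  show "op_scale Dend n c (dend_cls n f) = dend_cls n (Poly_Mapping.map ((*) c) f)"
    if "f \<in> op_space free_operad n"
  proof -
    have "dend_cls n (Poly_Mapping.map ((*) c) x) = dend_cls n (Poly_Mapping.map ((*) c) f)"
      if "x \<in> dend_cls n f" for x
      using that operad_cong.scale[of free_operad dend_rel n x f c]
      by (intro dend_cls_eq) (auto simp: operad_cong_set_def free_operad_simps intro: operad_cong.sym)
    moreover have "f \<in> dend_cls n f"
      using that by (auto simp: operad_cong_set_def intro: operad_cong.refl)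
    ultimately show ?thesis
      unfolding Dend_def quotient_operad_def free_operad_simps ns_operad.simps
      by (intro UN)
  qed
  show "op_unit Dend = dend_cls 1 (of_tree \<langle>\<rangle>)"
    by (simp add: Dend_def quotient_operad_def free_operad_simps)
  show "op_comp Dend m n i (dend_cls m f) (dend_cls n g') =
     dend_cls (m + n - 1) (op_comp free_operad m n i f g')"
    if "f \<in> op_space free_operad m" "g' \<in> op_space free_operad n" "1 \<le> n" "1 \<le> i" "i \<le> m"
  proof -
    have "dend_cls (m + n - 1) (op_comp free_operad m n i x y) =
        dend_cls (m + n - 1) (op_comp free_operad m n i f g')"
      if "x \<in> dend_cls m f" "y \<in> dend_cls n g'" for x y
      using that \<open>1 \<le> n\<close> \<open>1 \<le> i\<close> \<open>i \<le> m\<close>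
      by (intro dend_cls_eq operad_cong.comp) (auto simp: operad_cong_set_def intro: operad_cong.sym)
    moreover have "f \<in> dend_cls m f" "g' \<in> dend_cls n g'"
      using that by (auto simp: operad_cong_set_def intro: operad_cong.refl)
    ultimately show ?thesis
      unfolding Dend_def quotient_operad_def ns_operad.simps
      by (intro UN)
  qed
qed

lemma dend_class_eq: "dend_class x = dend_cls 2 (free_gen x)"
  by (simp add: dend_class_def)

lemma free_gen_space: "free_gen x \<in> op_space free_operad 2"
  by (simp add: free_gen_def free_space_single)

text \<open>
  The morphism \<open>\<psi>\<close>: the value of any representative of the class.
\<close>

definition mould_map :: "nat \<Rightarrow> (dend_gen tree \<Rightarrow>\<^sub>0 rat) set \<Rightarrow> ratfun" where
  "mould_map n X = free_value rconst (vars n) (SOME f. f \<in> X)"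

lemma mould_map_dend_cls:
  assumes "f \<in> op_space free_operad n" "1 \<le> n"
  shows "mould_map n (dend_cls n f) = free_value rconst (vars n) f"
proof -
  have "f \<in> dend_cls n f" using assms by (auto simp: operad_cong_set_def intro: operad_cong.refl)
  then have "(SOME g. g \<in> dend_cls n f) \<in> dend_cls n f" by (rule someI)
  then show ?thesis
    unfolding mould_map_def using dend_cong_free_value[OF _ assms(2)] by (simp add: operad_cong_set_def)
qed

lemma operad_hom_mould_map: "operad_hom Dend Mould mould_map"
  unfolding operad_hom_def
proof (intro conjI allI impI ballI)
  note simps = mould_map_dend_cls Dend_ops free_space_add free_space_scale
    free_value_add[OF ring_morphism_rconst] free_value_scale[OF ring_morphism_rconst]
  fix n :: nat and X assume n: "1 \<le> n" and X: "X \<in> op_space Dend n"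
  from X obtain f where f: "f \<in> op_space free_operad n" "X = dend_cls n f" by (auto simp: Dend_space)
  show "mould_map n X \<in> op_space Mould n" using f n by (simp add: simps free_value_in_Mould)
  show "mould_map n (op_scale Dend n c X) = op_scale Mould n c (mould_map n X)" for c
    using f n by (simp add: simps Mould_def)
  fix Y assume "Y \<in> op_space Dend n"
  then obtain g where g: "g \<in> op_space free_operad n" "Y = dend_cls n g" by (auto simp: Dend_space)
  show "mould_map n (op_add Dend n X Y) = op_add Mould n (mould_map n X) (mould_map n Y)"
    using f g n by (simp add: simps Mould_def)
next
  show "mould_map 1 (op_unit Dend) = op_unit Mould"
    using mould_map_dend_cls[of "of_tree \<langle>\<rangle>" 1]
    by (simp add: Dend_ops free_space_single free_value_single[OF ring_morphism_rconst]
        ring_morphism.one[OF ring_morphism_rconst] Mould_def vars_def)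
next
  fix m n i :: nat and X Y
  assume mn: "1 \<le> m" "1 \<le> n" "i \<in> {1..m}" and X: "X \<in> op_space Dend m" and Y: "Y \<in> op_space Dend n"
  from X obtain f where f: "f \<in> op_space free_operad m" "X = dend_cls m f" by (auto simp: Dend_space)
  from Y obtain g where g: "g \<in> op_space free_operad n" "Y = dend_cls n g" by (auto simp: Dend_space)
  have "op_comp free_operad m n i f g \<in> op_space free_operad (m + n - 1)"
    using free_space_comp[OF f(1) g(1)] mn by (simp add: free_operad_simps(5))
  moreover have "1 \<le> m + n - 1" using mn(1,2) by linarith
  ultimately show "mould_map (m + n - 1) (op_comp Dend m n i X Y) =
      op_comp Mould m n i (mould_map m X) (mould_map n Y)"
    using f g mn mould_comp_free_value[OF f(1) g(1)] by (simp add: mould_map_dend_cls Dend_ops(4))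
qed

lemma mould_map_generators:
  "mould_map 2 (dend_class L) = 1 / (u 1 * (u 1 + u 2))"
  "mould_map 2 (dend_class R) = 1 / ((u 1 + u 2) * u 2)"
proof -
  have "vars 2 = [u 1, u 2]" by (simp add: vars_def upt_rec numeral_eq_Suc)
  moreover have "u 1 \<noteq> 0" "u 2 \<noteq> 0"
    using zero_sum_free_sum[OF zero_sum_free_u[of "[1]"]] zero_sum_free_sum[OF zero_sum_free_u[of "[2]"]]
    by simp_all
  ultimately show "mould_map 2 (dend_class L) = 1 / (u 1 * (u 1 + u 2))"
    "mould_map 2 (dend_class R) = 1 / ((u 1 + u 2) * u 2)"
    by (simp_all add: dend_class_eq mould_map_dend_cls free_gen_space)
      (simp_all add: free_gen_def free_value_single[OF ring_morphism_rconst]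
        ring_morphism.one[OF ring_morphism_rconst])
qed

section \<open>Uniqueness and injectivity\<close>

lemma operad_homD:
  assumes "operad_hom P Q \<psi>"
  shows "\<psi> 1 (op_unit P) = op_unit Q"
    and "1 \<le> n \<Longrightarrow> x \<in> op_space P n \<Longrightarrow> y \<in> op_space P n \<Longrightarrow>
      \<psi> n (op_add P n x y) = op_add Q n (\<psi> n x) (\<psi> n y)"
    and "1 \<le> n \<Longrightarrow> x \<in> op_space P n \<Longrightarrow> \<psi> n (op_scale P n c x) = op_scale Q n c (\<psi> n x)"
    and "1 \<le> n \<Longrightarrow> 1 \<le> i \<Longrightarrow> i \<le> m \<Longrightarrow> x \<in> op_space P m \<Longrightarrow> y \<in> op_space P n \<Longrightarrow>
      \<psi> (m + n - 1) (op_comp P m n i x y) = op_comp Q m n i (\<psi> m x) (\<psi> n y)"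
  using assms by (simp_all add: operad_hom_def)

text \<open>
  Each tree \<open>\<langle>l, x, r\<rangle>\<close> is the composite \<open>(x \<circ>\<^sub>2 r) \<circ>\<^sub>1 l\<close>, so two morphisms that agree on the
  generators agree on all trees.
\<close>

lemma operad_hom_Dend_unique:
  assumes \<phi>: "operad_hom Dend Mould \<phi>" and \<psi>: "operad_hom Dend Mould \<psi>"
    and gen: "\<And>x. \<phi> 2 (dend_class x) = \<psi> 2 (dend_class x)"
    and n: "1 \<le> n" and X: "X \<in> op_space Dend n"
  shows "\<phi> n X = \<psi> n X"
proof -
  have homs: "operad_hom Dend Mould \<chi>" if "\<chi> \<in> {\<phi>, \<psi>}" for \<chi>
    using that \<phi> \<psi> by auto
  note unit = operad_homD(1)[OF homs]
  have cls: "dend_cls n f \<in> op_space Dend n" if "f \<in> op_space free_operad n" for n f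
    using that by (auto simp: Dend_space)
  have add: "\<chi> n (op_add Dend n (dend_cls n f) (dend_cls n g)) =
      op_add Mould n (\<chi> n (dend_cls n f)) (\<chi> n (dend_cls n g))"
    if "\<chi> \<in> {\<phi>, \<psi>}" "1 \<le> n" "f \<in> op_space free_operad n" "g \<in> op_space free_operad n" for \<chi> n f g
    by (rule operad_homD(2)[OF homs[OF that(1)] that(2) cls[OF that(3)] cls[OF that(4)]])
  have scale: "\<chi> n (op_scale Dend n c (dend_cls n f)) = op_scale Mould n c (\<chi> n (dend_cls n f))"
    if "\<chi> \<in> {\<phi>, \<psi>}" "1 \<le> n" "f \<in> op_space free_operad n" for \<chi> n c f
    by (rule operad_homD(3)[OF homs[OF that(1)] that(2) cls[OF that(3)]])
  have comp: "\<chi> (m + n - 1) (op_comp Dend m n i (dend_cls m f) (dend_cls n g)) =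
      op_comp Mould m n i (\<chi> m (dend_cls m f)) (\<chi> n (dend_cls n g))"
    if "\<chi> \<in> {\<phi>, \<psi>}" "1 \<le> n" "1 \<le> i" "i \<le> m" "f \<in> op_space free_operad m" "g \<in> op_space free_operad n"
    for \<chi> m n i f g
    by (rule operad_homD(4)[OF homs[OF that(1)] that(2-4) cls[OF that(5)] cls[OF that(6)]])
  have tree: "\<phi> (size1 t) (dend_cls (size1 t) (of_tree t)) = \<psi> (size1 t) (dend_cls (size1 t) (of_tree t))" for t
  proof (induction t)
    case Leaf
    show ?case using unit[of \<phi>] unit[of \<psi>] by (simp add: Dend_ops)
  next
    case (Node l x r)
    let ?r = "of_tree r" and ?l = "of_tree l"
    let ?g = "op_comp free_operad 2 (size1 r) 2 (free_gen x) ?r"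
    have space: "?r \<in> op_space free_operad (size1 r)" "?l \<in> op_space free_operad (size1 l)"
      by (simp_all add: free_space_single)
    have g: "?g = of_tree \<langle>\<langle>\<rangle>, x, r\<rangle>"
      by (simp add: free_operad_simps free_gen_def bilinear_ext_simps)
    have g': "?g \<in> op_space free_operad (Suc (size1 r))"
      unfolding g by (rule free_space_single) simp
    have pos: "1 \<le> size1 l" "1 \<le> size1 r" by (simp_all add: Suc_le_eq)
    have 1: "\<phi> (Suc (size1 r)) (dend_cls (Suc (size1 r)) ?g) = \<psi> (Suc (size1 r)) (dend_cls (Suc (size1 r)) ?g)"
      using comp[of \<phi> "size1 r" 2 2 "free_gen x" ?r] comp[of \<psi> "size1 r" 2 2 "free_gen x" ?r]
        Dend_ops(4)[OF free_gen_space space(1) pos(2), of 2 x] gen[of x] Node.IH(2) space pos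
      by (simp add: free_gen_space dend_class_eq)
    have "op_comp free_operad (Suc (size1 r)) (size1 l) 1 ?g ?l = of_tree \<langle>l, x, r\<rangle>"
      unfolding g by (simp add: free_operad_simps bilinear_ext_simps)
    moreover have "Suc (size1 r) + size1 l - 1 = size1 l + size1 r" by simp
    ultimately show ?case
      using comp[of \<phi> "size1 l" 1 "Suc (size1 r)" ?g ?l] comp[of \<psi> "size1 l" 1 "Suc (size1 r)" ?g ?l]
        Dend_ops(4)[OF g' space(2) pos(1), of 1] 1 Node.IH(1) space pos g'
      by (simp add: add.commute)
  qed
  obtain f where f: "f \<in> op_space free_operad n" "X = dend_cls n f" using X by (auto simp: Dend_space)
  have single: "\<phi> n (dend_cls n (Poly_Mapping.single t c)) = \<psi> n (dend_cls n (Poly_Mapping.single t c))"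
    if "t \<in> Poly_Mapping.keys f" for t c
  proof -
    have "size1 t = n" using f(1) that by (simp add: free_operad_simps)
    then show ?thesis
      using scale[of \<phi> n "of_tree t" c] scale[of \<psi> n "of_tree t" c] tree[of t] n
      by (simp add: free_space_single Dend_ops)
  qed
  have "\<phi> n (dend_cls n (\<Sum>t\<in>S. Poly_Mapping.single t (Poly_Mapping.lookup f t))) =
      \<psi> n (dend_cls n (\<Sum>t\<in>S. Poly_Mapping.single t (Poly_Mapping.lookup f t)))"
    if "finite S" "S \<subseteq> Poly_Mapping.keys f" for S
    using that
  proof (induction S rule: finite_induct)
    case empty
    have "Poly_Mapping.map ((*) (0::rat)) (0 :: dend_gen tree \<Rightarrow>\<^sub>0 rat) = 0"
      by (intro poly_mapping_eqI) (simp add: lookup_scale)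
    then have "\<chi> n (dend_cls n 0) = 0" if "\<chi> \<in> {\<phi>, \<psi>}" for \<chi>
      using scale[OF that n free_space_0, of 0] ring_morphism.zero[OF ring_morphism_rconst]
      by (simp add: Dend_ops free_space_0 Mould_def)
    from this[of \<phi>] this[of \<psi>] show ?case by simp
  next
    case (insert t S)
    let ?S = "\<Sum>t\<in>S. Poly_Mapping.single t (Poly_Mapping.lookup f t)"
    let ?t = "Poly_Mapping.single t (Poly_Mapping.lookup f t)"
    have size: "size1 s = n" if "s \<in> insert t S" for s
      using that insert.prems f(1) by (auto simp: free_operad_simps)
    have space: "?t \<in> op_space free_operad n" "?S \<in> op_space free_operad n"
      by (intro free_space_sum free_space_single size; simp)+
    show ?case
      using insert single[of t] add[OF _ n space, of \<phi>] add[OF _ n space, of \<psi>] Dend_ops(1)[OF space]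
      by simp
  qed
  from this[OF finite_keys subset_refl] show ?thesis by (simp add: sum_of_singles f)
qed

lemma basis_tree_inject:
  "T \<noteq> \<langle>\<rangle> \<Longrightarrow> T' \<noteq> \<langle>\<rangle> \<Longrightarrow> basis_tree T = basis_tree T' \<Longrightarrow> T = T'"
  "right_factor B = right_factor B' \<Longrightarrow> B = B'"
proof (induction T and B arbitrary: T' and B' rule: basis_tree_right_factor.induct)
  case (2 A v B)
  obtain A' v' B' where T': "T' = \<langle>A', v', B'\<rangle>" using 2(5) by (cases T') auto
  have not_L: "right_factor C \<noteq> \<langle>s, L, t\<rangle>" for C s t by (simp add: right_factor.simps)
  show ?case
  proof (cases "A = \<langle>\<rangle>")
    case True
    then have "A' = \<langle>\<rangle>" "right_factor B = right_factor B'"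
      using 2(6) not_L[of B] by (auto simp: T' split: if_splits)
    then show ?thesis using 2(1)[OF True, of B'] True T' by simp
  next
    case False
    then have "A' \<noteq> \<langle>\<rangle>" "basis_tree A = basis_tree A'" "right_factor B = right_factor B'"
      using 2(6) not_L[of B', symmetric] by (auto simp: T' split: if_splits)
    then show ?thesis using 2(2)[OF False False, of A'] 2(3)[OF False, of B'] T' by simp
  qed
next
  case (3 B)
  show ?case
  proof (cases "B = \<langle>\<rangle>")
    case True
    then show ?thesis using 3(2) by (simp add: right_factor.simps split: if_splits)
  next
    case False
    then have "B' \<noteq> \<langle>\<rangle>" "basis_tree B = basis_tree B'"
      using 3(2) by (auto simp: right_factor.simps split: if_splits)
    then show ?thesis using 3(1)[OF False False] by simp
  qed
qed simp

text \<open>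
  A relation between the images of the basis elements, evaluated at positive reals, is a relation
  between the functions \<^const>\<open>tree_mould\<close>.
\<close>

lemma free_value_inject_basis_trees:
  assumes "Poly_Mapping.keys d \<subseteq> basis_trees n" "1 \<le> n" "free_value rconst (vars n) d = 0"
  shows "d = 0"
proof -
  define c where "c T = (of_rat (Poly_Mapping.lookup d (basis_tree T)) :: real)" for T
  have ne: "T \<noteq> \<langle>\<rangle>" if "size T = n" for T :: "unit tree" using that assms(2) by auto
  have inj: "inj_on basis_tree {T. size T = n}"
    by (rule inj_onI) (use ne basis_tree_inject(1) in blast)
  have basis: "basis_trees n = basis_tree ` {T. size T = n}"
    using ne by (auto simp: basis_trees_def)
  have space: "d \<in> op_space free_operad n"
    using assms(1) by (auto simp: free_operad_simps basis_trees_def size1_basis_tree)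
  have "c T = 0" if "size T = n" for T
    using _ that
  proof (rule tree_mould_independent)
    fix xs :: "real list" assume xs: "length xs = n" "\<forall>x\<in>set xs. 0 < x"
    define \<sigma> where "\<sigma> k = xs ! (k - 1)" for k
    have "list_all2 (specializes (peval of_rat \<sigma>)) (vars n) xs"
      using xs(1) specializes_u[OF ring_morphism_of_rat, of \<sigma> "Suc i" for i]
      by (simp add: list_all2_conv_all_nth \<sigma>_def vars_def del: upt_Suc)
    then have "specializes (peval of_rat \<sigma>) (free_value rconst (vars n) d) (free_value of_rat xs d)"
      using xs space by (intro specializes_free_value ring_morphism_of_rat zero_sum_free_positive) auto
    then have "free_value of_rat xs d = 0"
      using specializes_unique[OF _ _ specializes_0] ring_morphism_peval[OF ring_morphism_of_rat] assms(3)
      by metis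
    moreover have "free_value of_rat xs d =
        (\<Sum>t\<in>basis_trees n. of_rat (Poly_Mapping.lookup d t) * tree_value t xs)"
      unfolding free_value_def
      by (rule sum.mono_neutral_left) (use assms(1) finite_unit_trees in \<open>auto simp: basis in_keys_iff\<close>)
    also have "\<dots> = (\<Sum>T | size T = n. c T * tree_mould T xs)"
      unfolding basis sum.reindex[OF inj]
      by (intro sum.cong HOL.refl)
        (use xs ne in \<open>auto simp: c_def tree_value_basis_tree(1) zero_sum_free_positive\<close>)
    finally show "(\<Sum>T | size T = n. c T * tree_mould T xs) = 0" by simp
  qed
  then have "Poly_Mapping.lookup d t = 0" for t
    using assms(1) by (cases "t \<in> basis_trees n") (auto simp: basis c_def in_keys_iff)
  then show ?thesis by (intro poly_mapping_eqI) simp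
qed

lemma inj_mould_map:
  assumes "1 \<le> n"
  shows "inj_on (mould_map n) (op_space Dend n)"
proof (rule inj_onI)
  fix X Y assume "X \<in> op_space Dend n" "Y \<in> op_space Dend n" and eq: "mould_map n X = mould_map n Y"
  then obtain f g where f: "f \<in> op_space free_operad n" "X = dend_cls n f"
    and g: "g \<in> op_space free_operad n" "Y = dend_cls n g" by (auto simp: Dend_space)
  from f(1) obtain f' where f': "Poly_Mapping.keys f' \<subseteq> basis_trees n" "dend_cong n f f'"
    using spanned_by_basis_trees unfolding spanned_by_def by blast
  from g(1) obtain g' where g': "Poly_Mapping.keys g' \<subseteq> basis_trees n" "dend_cong n g g'"
    using spanned_by_basis_trees unfolding spanned_by_def by blast
  have "free_value rconst (vars n) (f' - g') = 0"
    using eq f g assms dend_cong_free_value[OF f'(2) assms] dend_cong_free_value[OF g'(2) assms]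
    by (simp add: mould_map_dend_cls free_value_diff[OF ring_morphism_rconst])
  moreover have "Poly_Mapping.keys (f' - g') \<subseteq> basis_trees n"
    using f'(1) g'(1) keys_diff[of f' g'] by blast
  ultimately have "f' = g'"
    using free_value_inject_basis_trees[of "f' - g'" n] assms by simp
  then have "dend_cong n f g" using f'(2) g'(2) by (blast intro: operad_cong.trans operad_cong.sym)
  then show "X = Y" using f g by (simp add: dend_cls_eq)
qed

theorem theorem3p4:
  shows "\<exists>\<psi>.
    (operad_hom Dend Mould \<psi> \<and>
     \<psi> 2 (dend_class L) = 1 / (u 1 * (u 1 + u 2)) \<and>
     \<psi> 2 (dend_class R) = 1 / ((u 1 + u 2) * u 2)) \<and>
    (\<forall>\<phi>. operad_hom Dend Mould \<phi> \<and>
         \<phi> 2 (dend_class L) = 1 / (u 1 * (u 1 + u 2)) \<and>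
         \<phi> 2 (dend_class R) = 1 / ((u 1 + u 2) * u 2) \<longrightarrow>
         (\<forall>n\<ge>1. \<forall>x\<in>op_space Dend n. \<phi> n x = \<psi> n x)) \<and>
    (\<forall>n\<ge>1. inj_on (\<psi> n) (op_space Dend n))"
proof (intro exI[of _ mould_map] conjI allI impI ballI)
  fix \<phi> n x
  assume \<phi>: "operad_hom Dend Mould \<phi> \<and>
         \<phi> 2 (dend_class L) = 1 / (u 1 * (u 1 + u 2)) \<and>
         \<phi> 2 (dend_class R) = 1 / ((u 1 + u 2) * u 2)"
    and "1 \<le> n" "x \<in> op_space Dend n"
  moreover have "\<phi> 2 (dend_class y) = mould_map 2 (dend_class y)" for y
    using \<phi> by (cases y) (simp_all add: mould_map_generators)
  ultimately show "\<phi> n x = mould_map n x"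
    using operad_hom_Dend_unique[OF _ operad_hom_mould_map] by blast
qed (simp_all add: operad_hom_mould_map mould_map_generators inj_mould_map)

end
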